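(* There exists a primitive matrix $A\in M_2(\{0,1\})$ such that $\mathbb G_A^\infty=\widehat{\mathbb F}_2$ (i.e. the canonical surjection $C(\mathbb G_A^\infty)\to C(\widehat{\mathbb F}_2)$, $u_{ij}\mapsto\delta_{ij}g_i$, where $g_1,g_2$ are the free generators of $\mathbb F_2$, is an isomorphism) but $\mathrm{QAut}(T_A)$ is non-trivial, where $T_A=(A^t\otimes A)\Sigma$ and $\Sigma$ is the flip map on $\mathbb C^2\otimes\mathbb C^2$.
   Context: $A\in M_N(\{0,1\})$ is primitive if some power of $A$ has strictly positive entries; $\vec u$ is its right Perron--Frobenius eigenvector (positive entries summing to $1$). $V_A^n$ is the set of words $x_1\cdots x_n$ over $\{1,\dots,N\}$ with $A_{x_i,x_{i+1}}=1$ for all $i$. A magic unitary is a square matrix of projections in a unital $C^*$-algebra with all rows and columns summing to $1$. $C(\mathbb G_A^\infty)$ is the universal unital $C^*$-algebra generated by partial isometries $(u_{ij})_{1\le i,j\le N}$ such that, with $p_{ij}=u_{ij}u_{ij}^*$ and $q_{ij}=u_{ij}^*u_{ij}$: (I) $p,q$ are magic unitaries with $p\vec u=\vec u1=q\vec u$; (II) $Ap=qA$; (III) for all $n\in\mathbb N$ and $\alpha,\beta\in V_A^n$, $u_{\alpha_1\beta_1}\cdots u_{\alpha_n\beta_n}$ is a partial isometry. Its coproduct is $u_{ij}\mapsto\sum_ku_{ik}\otimes u_{kj}$. $\widehat{\mathbb F}_N$ is the dual of the free group: $C(\widehat{\mathbb F}_N)=C^*(\mathbb F_N)$ with coproduct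 $g\mapsto g\otimes g$. For an $m\times m$ matrix $T$, the quantum automorphism group $\mathrm{QAut}(T)$ is the compact quantum group for which $C(\mathrm{QAut}(T))$ is the universal unital $C^*$-algebra generated by the entries of an $m\times m$ magic unitary $p$ with $Tp=pT$, with coproduct $p_{ij}\mapsto\sum_kp_{ik}\otimes p_{kj}$; it is trivial if $C(\mathrm{QAut}(T))=\mathbb C1$. *)

theory Defs
  imports "HOL-Analysis.Analysis" "HOL-Algebra.Ring" "HOL-Library.Poly_Mapping"
begin

section \<open>Unital C*-algebras\<close>

record 'a cstar = "'a ring" +
  cscale :: "complex \<Rightarrow> 'a \<Rightarrow> 'a"
  cadj :: "'a \<Rightarrow> 'a"
  cnorm :: "'a \<Rightarrow> real"

text \<open>The zero algebra is admitted, so the unit is not required to have norm one.\<close>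

locale unital_cstar = ring A for A :: "('a, 'z) cstar_scheme" (structure) +
  assumes cscale_closed: "x \<in> carrier A \<Longrightarrow> cscale A c x \<in> carrier A"
    and cscale_add: "\<lbrakk>x \<in> carrier A; y \<in> carrier A\<rbrakk> \<Longrightarrow> cscale A c (x \<oplus> y) = cscale A c x \<oplus> cscale A c y"
    and cscale_plus: "x \<in> carrier A \<Longrightarrow> cscale A (c + d) x = cscale A c x \<oplus> cscale A d x"
    and cscale_cscale: "x \<in> carrier A \<Longrightarrow> cscale A c (cscale A d x) = cscale A (c * d) x"
    and cscale_one: "x \<in> carrier A \<Longrightarrow> cscale A 1 x = x"
    and cscale_mult_left: "\<lbrakk>x \<in> carrier A; y \<in> carrier A\<rbrakk> \<Longrightarrow> cscale A c (x \<otimes> y) = cscale A c x \<otimes> y"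
    and cscale_mult_right: "\<lbrakk>x \<in> carrier A; y \<in> carrier A\<rbrakk> \<Longrightarrow> cscale A c (x \<otimes> y) = x \<otimes> cscale A c y"
    and cadj_closed: "x \<in> carrier A \<Longrightarrow> cadj A x \<in> carrier A"
    and cadj_add: "\<lbrakk>x \<in> carrier A; y \<in> carrier A\<rbrakk> \<Longrightarrow> cadj A (x \<oplus> y) = cadj A x \<oplus> cadj A y"
    and cadj_cscale: "x \<in> carrier A \<Longrightarrow> cadj A (cscale A c x) = cscale A (cnj c) (cadj A x)"
    and cadj_mult: "\<lbrakk>x \<in> carrier A; y \<in> carrier A\<rbrakk> \<Longrightarrow> cadj A (x \<otimes> y) = cadj A y \<otimes> cadj A x"
    and cadj_cadj: "x \<in> carrier A \<Longrightarrow> cadj A (cadj A x) = x"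
    and cnorm_nonneg: "x \<in> carrier A \<Longrightarrow> 0 \<le> cnorm A x"
    and cnorm_eq_0: "x \<in> carrier A \<Longrightarrow> cnorm A x = 0 \<longleftrightarrow> x = \<zero>"
    and cnorm_triangle: "\<lbrakk>x \<in> carrier A; y \<in> carrier A\<rbrakk> \<Longrightarrow> cnorm A (x \<oplus> y) \<le> cnorm A x + cnorm A y"
    and cnorm_cscale: "x \<in> carrier A \<Longrightarrow> cnorm A (cscale A c x) = cmod c * cnorm A x"
    and cnorm_mult: "\<lbrakk>x \<in> carrier A; y \<in> carrier A\<rbrakk> \<Longrightarrow> cnorm A (x \<otimes> y) \<le> cnorm A x * cnorm A y"
    and cstar_identity: "x \<in> carrier A \<Longrightarrow> cnorm A (cadj A x \<otimes> x) = (cnorm A x)\<^sup>2"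
    and complete: "\<lbrakk>\<And>n::nat. X n \<in> carrier A; \<And>e. 0 < e \<Longrightarrow> \<exists>N. \<forall>m\<ge>N. \<forall>n\<ge>N. cnorm A (X m \<ominus> X n) < e\<rbrakk>
        \<Longrightarrow> \<exists>L\<in>carrier A. (\<lambda>n. cnorm A (X n \<ominus> L)) \<longlonglongrightarrow> 0"

definition cstar_hom :: "('a, 'y) cstar_scheme \<Rightarrow> ('b, 'z) cstar_scheme \<Rightarrow> ('a \<Rightarrow> 'b) set" where
  "cstar_hom A B = {\<phi> \<in> ring_hom A B.
     (\<forall>c. \<forall>x\<in>carrier A. \<phi> (cscale A c x) = cscale B c (\<phi> x)) \<and>
     (\<forall>x\<in>carrier A. \<phi> (cadj A x) = cadj B (\<phi> x))}"

definition cstar_iso :: "('a, 'y) cstar_scheme \<Rightarrow> ('b, 'z) cstar_scheme \<Rightarrow> ('a \<Rightarrow> 'b) set" where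
  "cstar_iso A B = {\<phi> \<in> cstar_hom A B. bij_betw \<phi> (carrier A) (carrier B)}"


section \<open>The *-algebra of a monoid with involution\<close>

class star_monoid = monoid_add +
  fixes mstar :: "'a \<Rightarrow> 'a"
  assumes mstar_add: "mstar (x + y) = mstar y + mstar x"
    and mstar_mstar [simp]: "mstar (mstar x) = x"

text \<open>The monoid is written additively because the convolution product of
  \<^theory>\<open>HOL-Library.Poly_Mapping\<close> is; it need not be commutative. The type below,
  finitely supported functions on the monoid, is the monoid algebra over the complex numbers.\<close>

type_synonym 'm star_alg = "'m \<Rightarrow>\<^sub>0 complex"

definition scale :: "complex \<Rightarrow> 'm::star_monoid star_alg \<Rightarrow> 'm star_alg" where
  "scale c x = Poly_Mapping.single 0 c * x"

definition star :: "'m::star_monoid star_alg \<Rightarrow> 'm star_alg" where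
  "star x = Poly_Mapping.map cnj (Poly_Mapping.map_key mstar x)"

abbreviation basis :: "'m::star_monoid \<Rightarrow> 'm star_alg" where
  "basis m \<equiv> Poly_Mapping.single m 1"

lemma mstar_0 [simp]: "mstar (0::'m::star_monoid) = 0"
  by (metis add.left_neutral add.right_neutral mstar_add mstar_mstar)

lemma inj_mstar: "inj (mstar :: 'm::star_monoid \<Rightarrow> 'm)"
  by (metis injI mstar_mstar)

lemma lookup_star: "Poly_Mapping.lookup (star x) m = cnj (Poly_Mapping.lookup x (mstar m))"
  unfolding star_def
  by (simp add: Poly_Mapping.map.rep_eq map_key.rep_eq inj_mstar when_def)

lemma star_single [simp]: "star (Poly_Mapping.single m c) = Poly_Mapping.single (mstar m) (cnj c)"
  by (rule poly_mapping_eqI) (auto simp: lookup_star lookup_single when_def)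

lemma star_add: "star (x + y) = star x + star y"
  by (rule poly_mapping_eqI) (simp add: lookup_star lookup_add)

lemma star_star [simp]: "star (star x) = x"
  by (rule poly_mapping_eqI) (simp add: lookup_star)

lemma star_0 [simp]: "star 0 = 0"
  by (rule poly_mapping_eqI) (simp add: lookup_star)

lemma star_uminus: "star (- x) = - star x"
  by (rule poly_mapping_eqI) (simp add: lookup_star)

lemma star_diff: "star (x - y) = star x - star y"
  using star_add[of x "- y"] by (simp add: star_uminus)

lemma star_alg_induct [case_names zero single add]:
  fixes x :: "'m::star_monoid star_alg"
  assumes "P 0" "\<And>m c. P (Poly_Mapping.single m c)" "\<And>x y. P x \<Longrightarrow> P y \<Longrightarrow> P (x + y)"
  shows "P x"
proof -
  have "P (\<Sum>k\<in>K. Poly_Mapping.single k (Poly_Mapping.lookup x k))" if "finite K" for K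
    using that by induction (auto intro: assms)
  moreover have "x = (\<Sum>k\<in>Poly_Mapping.keys x. Poly_Mapping.single k (Poly_Mapping.lookup x k))"
    by (rule poly_mapping_eqI)
       (auto simp: lookup_sum lookup_single when_def in_keys_iff sum.delta)
  ultimately show ?thesis by (metis finite_keys)
qed

lemma star_mult: "star (x * y) = star y * star (x :: 'm::star_monoid star_alg)"
proof (induction x rule: star_alg_induct)
  case (single m c)
  show ?case
    by (induction y rule: star_alg_induct)
       (auto simp: mult_single mstar_add star_add distrib_left distrib_right mult.commute)
qed (auto simp: star_add distrib_left distrib_right)

lemma star_1 [simp]: "star 1 = (1 :: 'm::star_monoid star_alg)"
  by (metis complex_cnj_one mstar_0 single_one star_single)

lemma scale_mult_right: "scale c (x * y) = x * scale c (y :: 'm::star_monoid star_alg)"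
proof -
  have "Poly_Mapping.single 0 c * x = x * Poly_Mapping.single 0 c"
    by (induction x rule: star_alg_induct)
       (auto simp: mult_single distrib_left distrib_right mult.commute)
  then show ?thesis by (metis mult.assoc scale_def)
qed

lemma scale_mult_left: "scale c (x * y) = scale c x * (y :: 'm::star_monoid star_alg)"
  by (simp add: scale_def mult.assoc)

lemma scale_add: "scale c (x + y) = scale c x + scale c (y :: 'm::star_monoid star_alg)"
  by (simp add: scale_def distrib_left)

lemma scale_diff: "scale c (x - y) = scale c x - scale c (y :: 'm::star_monoid star_alg)"
  by (simp add: scale_def right_diff_distrib)

lemma scale_plus: "scale (c + d) x = scale c x + scale d (x :: 'm::star_monoid star_alg)"
  by (simp add: scale_def single_add distrib_right)

lemma scale_scale: "scale c (scale d x) = scale (c * d) (x :: 'm::star_monoid star_alg)"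
  by (simp add: scale_def mult_single flip: mult.assoc)

lemma scale_1 [simp]: "scale 1 x = (x :: 'm::star_monoid star_alg)"
  by (simp add: scale_def)

lemma scale_0 [simp]: "scale 0 x = (0 :: 'm::star_monoid star_alg)"
  by (simp add: scale_def)

lemma scale_uminus_1: "scale (-1) x = - (x :: 'm::star_monoid star_alg)"
  by (simp add: scale_def single_uminus)

lemma star_scale: "star (scale c x) = scale (cnj c) (star (x :: 'm::star_monoid star_alg))"
proof -
  have "star (scale c x) = star x * scale (cnj c) 1"
    by (simp add: scale_def star_mult)
  then show ?thesis by (simp flip: scale_mult_right)
qed

lemma single_eq_scale: "Poly_Mapping.single m c = scale c (basis (m :: 'm::star_monoid))"
  by (simp add: scale_def mult_single)


section \<open>C*-seminorms and completion\<close>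

definition cstar_seminorm :: "('m::star_monoid star_alg \<Rightarrow> real) \<Rightarrow> bool" where
  "cstar_seminorm \<nu> \<longleftrightarrow>
     (\<forall>x y. \<nu> (x + y) \<le> \<nu> x + \<nu> y) \<and>
     (\<forall>c x. \<nu> (scale c x) = cmod c * \<nu> x) \<and>
     (\<forall>x y. \<nu> (x * y) \<le> \<nu> x * \<nu> y) \<and>
     (\<forall>x. \<nu> (star x * x) = (\<nu> x)\<^sup>2)"

definition cauchy_seq :: "('m::star_monoid star_alg \<Rightarrow> real) \<Rightarrow> (nat \<Rightarrow> 'm star_alg) \<Rightarrow> bool" where
  "cauchy_seq \<nu> s \<longleftrightarrow> (\<forall>e>0. \<exists>N. \<forall>m\<ge>N. \<forall>n\<ge>N. \<nu> (s m - s n) < e)"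

definition null_seq :: "('m::star_monoid star_alg \<Rightarrow> real) \<Rightarrow> (nat \<Rightarrow> 'm star_alg) \<Rightarrow> bool" where
  "null_seq \<nu> s \<longleftrightarrow> (\<lambda>n. \<nu> (s n)) \<longlonglongrightarrow> 0"

definition cauchy_class ::
    "('m::star_monoid star_alg \<Rightarrow> real) \<Rightarrow> (nat \<Rightarrow> 'm star_alg) \<Rightarrow> (nat \<Rightarrow> 'm star_alg) set" where
  "cauchy_class \<nu> s = {t. cauchy_seq \<nu> t \<and> null_seq \<nu> (\<lambda>n. t n - s n)}"

definition some_rep :: "(nat \<Rightarrow> 'm::star_monoid star_alg) set \<Rightarrow> nat \<Rightarrow> 'm star_alg" where
  "some_rep X = (SOME s. s \<in> X)"

text \<open>Hausdorff completion with respect to a C*-seminorm: Cauchy sequences modulo null sequences.\<close>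

definition cstar_completion ::
    "('m::star_monoid star_alg \<Rightarrow> real) \<Rightarrow> (nat \<Rightarrow> 'm star_alg) set cstar" where
  "cstar_completion \<nu> =
    \<lparr>carrier = cauchy_class \<nu> ` {s. cauchy_seq \<nu> s},
     mult = (\<lambda>X Y. cauchy_class \<nu> (\<lambda>n. some_rep X n * some_rep Y n)),
     one = cauchy_class \<nu> (\<lambda>n. 1),
     zero = cauchy_class \<nu> (\<lambda>n. 0),
     add = (\<lambda>X Y. cauchy_class \<nu> (\<lambda>n. some_rep X n + some_rep Y n)),
     cscale = (\<lambda>c X. cauchy_class \<nu> (\<lambda>n. scale c (some_rep X n))),
     cadj = (\<lambda>X. cauchy_class \<nu> (\<lambda>n. star (some_rep X n))),
     cnorm = (\<lambda>X. lim (\<lambda>n. \<nu> (some_rep X n)))\<rparr>"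


section \<open>Universal C*-algebras\<close>

text \<open>A set \<open>R\<close> of pairs stands for the relations \<open>a = b\<close>, \<open>(a, b) \<in> R\<close>. The C*-seminorms
  respecting them are exactly the functions \<open>x \<mapsto> \<parallel>\<pi> x\<parallel>\<close> for \<open>\<pi>\<close> a unital *-homomorphism into a
  unital C*-algebra that satisfies the relations. As usual, the universal C*-algebra
  exists only if the supremum \<open>max_seminorm\<close> below is finite for every \<open>x\<close>; the predicate
  \<open>bounded_relations\<close> is proved below for all relations used in this theory.
  The resulting algebra is characterised by \<open>universal_property\<close>.\<close>

definition admissible ::
    "('m::star_monoid star_alg \<times> 'm star_alg) set \<Rightarrow> ('m star_alg \<Rightarrow> real) set" where
  "admissible R = {\<nu>. cstar_seminorm \<nu> \<and> (\<forall>(a, b)\<in>R. \<nu> (a - b) = 0)}"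

definition bounded_relations :: "('m::star_monoid star_alg \<times> 'm star_alg) set \<Rightarrow> bool" where
  "bounded_relations R \<longleftrightarrow> (\<forall>x. bdd_above ((\<lambda>\<nu>. \<nu> x) ` admissible R))"

definition max_seminorm ::
    "('m::star_monoid star_alg \<times> 'm star_alg) set \<Rightarrow> 'm star_alg \<Rightarrow> real" where
  "max_seminorm R x = (SUP \<nu>\<in>admissible R. \<nu> x)"

definition universal_cstar ::
    "('m::star_monoid star_alg \<times> 'm star_alg) set \<Rightarrow> (nat \<Rightarrow> 'm star_alg) set cstar" where
  "universal_cstar R = cstar_completion (max_seminorm R)"

definition universal_map ::
    "('m::star_monoid star_alg \<times> 'm star_alg) set \<Rightarrow> 'm star_alg \<Rightarrow> (nat \<Rightarrow> 'm star_alg) set" where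
  "universal_map R x = cauchy_class (max_seminorm R) (\<lambda>n. x)"

text \<open>Unital *-homomorphisms from the algebra on a type to a C*-algebra on a carrier.\<close>

definition star_rep :: "('a, 'z) cstar_scheme \<Rightarrow> ('m::star_monoid star_alg \<Rightarrow> 'a) \<Rightarrow> bool" where
  "star_rep B \<pi> \<longleftrightarrow>
     (\<forall>x. \<pi> x \<in> carrier B) \<and>
     (\<forall>x y. \<pi> (x + y) = \<pi> x \<oplus>\<^bsub>B\<^esub> \<pi> y) \<and>
     (\<forall>x y. \<pi> (x * y) = \<pi> x \<otimes>\<^bsub>B\<^esub> \<pi> y) \<and>
     \<pi> 1 = \<one>\<^bsub>B\<^esub> \<and>
     (\<forall>c x. \<pi> (scale c x) = cscale B c (\<pi> x)) \<and>
     (\<forall>x. \<pi> (star x) = cadj B (\<pi> x))"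

subsection \<open>The completion is a unital C*-algebra\<close>

context
  fixes \<nu> :: "'m::star_monoid star_alg \<Rightarrow> real"
  assumes sn: "cstar_seminorm \<nu>"
begin

lemma sn_add: "\<nu> (x + y) \<le> \<nu> x + \<nu> y"
  and sn_scale: "\<nu> (scale c x) = cmod c * \<nu> x"
  and sn_mult: "\<nu> (x * y) \<le> \<nu> x * \<nu> y"
  and sn_star_mult: "\<nu> (star x * x) = (\<nu> x)\<^sup>2"
  using sn by (auto simp: cstar_seminorm_def)

lemma sn_0: "\<nu> 0 = 0"
  using sn_scale[of 0 0] by simp

lemma sn_uminus: "\<nu> (- x) = \<nu> x"
  using sn_scale[of "-1" x] by (simp add: scale_uminus_1)

lemma sn_nonneg: "0 \<le> \<nu> x"
  using sn_add[of x "- x"] by (simp add: sn_0 sn_uminus)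

lemma sn_commute: "\<nu> (x - y) = \<nu> (y - x)"
  by (metis minus_diff_eq sn_uminus)

lemma sn_triangle: "\<nu> (x - z) \<le> \<nu> (x - y) + \<nu> (y - z)"
  using sn_add[of "x - y" "y - z"] by simp

lemma sn_abs: "\<bar>\<nu> x - \<nu> y\<bar> \<le> \<nu> (x - y)"
  using sn_add[of "x - y" y] sn_add[of "y - x" x] by (simp add: sn_commute)

lemma sn_star: "\<nu> (star x) = \<nu> x"
proof -
  have le: "\<nu> y \<le> \<nu> (star y)" for y
  proof (cases "\<nu> y = 0")
    case False
    then have "0 < \<nu> y" using sn_nonneg[of y] by simp
    moreover have "\<nu> y * \<nu> y \<le> \<nu> (star y) * \<nu> y"
      using sn_mult[of "star y" y] by (simp add: sn_star_mult power2_eq_square)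
    ultimately show ?thesis by simp
  qed (simp add: sn_nonneg)
  show ?thesis using le[of x] le[of "star x"] by simp
qed

lemma cauchy_const: "cauchy_seq \<nu> (\<lambda>n. x)"
  by (simp add: cauchy_seq_def sn_0)

lemma cauchy_add:
  assumes "cauchy_seq \<nu> s" "cauchy_seq \<nu> t"
  shows "cauchy_seq \<nu> (\<lambda>n. s n + t n)"
  unfolding cauchy_seq_def
proof (intro allI impI)
  fix e :: real assume "0 < e"
  then have e: "0 < e / 2" by simp
  obtain M where M: "\<And>m n. M \<le> m \<Longrightarrow> M \<le> n \<Longrightarrow> \<nu> (s m - s n) < e / 2"
    using assms(1) e unfolding cauchy_seq_def by meson
  obtain N where N: "\<And>m n. N \<le> m \<Longrightarrow> N \<le> n \<Longrightarrow> \<nu> (t m - t n) < e / 2"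
    using assms(2) e unfolding cauchy_seq_def by meson
  show "\<exists>N. \<forall>m\<ge>N. \<forall>n\<ge>N. \<nu> (s m + t m - (s n + t n)) < e"
  proof (intro exI[of _ "max M N"] allI impI)
    fix m n assume mn: "max M N \<le> m" "max M N \<le> n"
    have "\<nu> (s m + t m - (s n + t n)) \<le> \<nu> (s m - s n) + \<nu> (t m - t n)"
      using sn_add[of "s m - s n" "t m - t n"] by (simp add: algebra_simps)
    then show "\<nu> (s m + t m - (s n + t n)) < e" using M[of m n] N[of m n] mn by simp
  qed
qed

lemma cauchy_scale:
  assumes "cauchy_seq \<nu> s"
  shows "cauchy_seq \<nu> (\<lambda>n. scale c (s n))"
  unfolding cauchy_seq_def
proof (intro allI impI)
  fix e :: real assume "0 < e"
  then have "0 < e / (cmod c + 1)" by (simp add: add_nonneg_pos)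
  then obtain N where N: "\<And>m n. N \<le> m \<Longrightarrow> N \<le> n \<Longrightarrow> \<nu> (s m - s n) < e / (cmod c + 1)"
    using assms unfolding cauchy_seq_def by meson
  show "\<exists>N. \<forall>m\<ge>N. \<forall>n\<ge>N. \<nu> (scale c (s m) - scale c (s n)) < e"
  proof (intro exI[of _ N] allI impI)
    fix m n assume mn: "N \<le> m" "N \<le> n"
    have pos: "0 < cmod c + 1" by (simp add: add_nonneg_pos)
    have "\<nu> (scale c (s m) - scale c (s n)) = cmod c * \<nu> (s m - s n)"
      by (simp add: sn_scale flip: scale_diff)
    also have "\<dots> \<le> (cmod c + 1) * \<nu> (s m - s n)"
      by (simp add: mult_right_mono sn_nonneg)
    also have "\<dots> < e" using N[OF mn] pos by (simp add: pos_less_divide_eq mult.commute)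
    finally show "\<nu> (scale c (s m) - scale c (s n)) < e" .
  qed
qed

lemma cauchy_star: "cauchy_seq \<nu> s \<Longrightarrow> cauchy_seq \<nu> (\<lambda>n. star (s n))"
  by (simp add: cauchy_seq_def sn_star flip: star_diff)

lemma cauchy_norm_convergent:
  assumes "cauchy_seq \<nu> s"
  shows "convergent (\<lambda>n. \<nu> (s n))"
proof -
  have "Cauchy (\<lambda>n. \<nu> (s n))"
    unfolding Cauchy_def dist_real_def
    using assms sn_abs unfolding cauchy_seq_def by (meson order_le_less_trans)
  then show ?thesis by (simp add: Cauchy_convergent_iff)
qed

lemma cauchy_bounded:
  assumes "cauchy_seq \<nu> s"
  obtains B where "0 < B" "\<And>n. \<nu> (s n) \<le> B"
proof -
  obtain B where "0 < B" "\<And>n. norm (\<nu> (s n)) \<le> B"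
    using convergent_imp_Bseq[OF cauchy_norm_convergent[OF assms]] by (auto simp: Bseq_def)
  then show thesis using that[of B] by (simp add: abs_le_iff)
qed

lemma sn_mult_diff: "\<nu> (a * b - c * d) \<le> \<nu> a * \<nu> (b - d) + \<nu> (a - c) * \<nu> d"
proof -
  have "a * b - c * d = a * (b - d) + (a - c) * d" by (simp add: algebra_simps)
  then show ?thesis
    using sn_add[of "a * (b - d)" "(a - c) * d"] sn_mult[of a "b - d"] sn_mult[of "a - c" d] by simp
qed

lemma cauchy_mult:
  assumes "cauchy_seq \<nu> s" "cauchy_seq \<nu> t"
  shows "cauchy_seq \<nu> (\<lambda>n. s n * t n)"
  unfolding cauchy_seq_def
proof (intro allI impI)
  fix e :: real assume "0 < e"
  obtain B where B: "0 < B" "\<And>n. \<nu> (s n) \<le> B" using cauchy_bounded[OF assms(1)] by blast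
  obtain C where C: "0 < C" "\<And>n. \<nu> (t n) \<le> C" using cauchy_bounded[OF assms(2)] by blast
  have e: "0 < e / (2 * C)" "0 < e / (2 * B)" using B C \<open>0 < e\<close> by auto
  obtain M where M: "\<And>m n. M \<le> m \<Longrightarrow> M \<le> n \<Longrightarrow> \<nu> (s m - s n) < e / (2 * C)"
    using assms(1) e unfolding cauchy_seq_def by meson
  obtain N where N: "\<And>m n. N \<le> m \<Longrightarrow> N \<le> n \<Longrightarrow> \<nu> (t m - t n) < e / (2 * B)"
    using assms(2) e unfolding cauchy_seq_def by meson
  show "\<exists>N. \<forall>m\<ge>N. \<forall>n\<ge>N. \<nu> (s m * t m - s n * t n) < e"
  proof (intro exI[of _ "max M N"] allI impI)
    fix m n assume mn: "max M N \<le> m" "max M N \<le> n"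
    have "\<nu> (s m) * \<nu> (t m - t n) \<le> B * \<nu> (t m - t n)"
      using B(2) by (rule mult_right_mono) (rule sn_nonneg)
    also have "\<dots> < e / 2" using N[of m n] mn B(1) by (simp add: field_simps)
    finally have 1: "\<nu> (s m) * \<nu> (t m - t n) < e / 2" .
    have "\<nu> (s m - s n) * \<nu> (t n) \<le> \<nu> (s m - s n) * C"
      using C(2) by (rule mult_left_mono) (rule sn_nonneg)
    also have "\<dots> < e / 2" using M[of m n] mn C(1) by (simp add: field_simps)
    finally have 2: "\<nu> (s m - s n) * \<nu> (t n) < e / 2" .
    show "\<nu> (s m * t m - s n * t n) < e"
      using sn_mult_diff[of "s m" "t m" "s n" "t n"] 1 2 by simp
  qed
qed

lemmas cauchy_intros = cauchy_const cauchy_add cauchy_scale cauchy_star cauchy_mult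

lemma nullI: "(\<And>n. \<nu> (s n) \<le> f n) \<Longrightarrow> f \<longlonglongrightarrow> 0 \<Longrightarrow> null_seq \<nu> s"
  unfolding null_seq_def
  by (rule tendsto_sandwich[of "\<lambda>_. 0"]) (auto simp: sn_nonneg)

lemma null_0: "null_seq \<nu> (\<lambda>n. 0)"
  by (simp add: null_seq_def sn_0)

lemma null_add: "null_seq \<nu> s \<Longrightarrow> null_seq \<nu> t \<Longrightarrow> null_seq \<nu> (\<lambda>n. s n + t n)"
  by (rule nullI[of _ "\<lambda>n. \<nu> (s n) + \<nu> (t n)"]) (auto simp: null_seq_def sn_add intro!: tendsto_eq_intros)

lemma null_commute: "null_seq \<nu> (\<lambda>n. s n - t n) \<Longrightarrow> null_seq \<nu> (\<lambda>n. t n - s n)"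
  by (simp add: null_seq_def sn_commute)

lemma null_trans:
  assumes "null_seq \<nu> (\<lambda>n. s n - t n)" "null_seq \<nu> (\<lambda>n. t n - r n)"
  shows "null_seq \<nu> (\<lambda>n. s n - r n)"
  using null_add[OF assms] by simp

lemma class_eq:
  assumes "cauchy_seq \<nu> s" "cauchy_seq \<nu> t"
  shows "cauchy_class \<nu> s = cauchy_class \<nu> t \<longleftrightarrow> null_seq \<nu> (\<lambda>n. s n - t n)"
proof
  assume "cauchy_class \<nu> s = cauchy_class \<nu> t"
  moreover have "s \<in> cauchy_class \<nu> s" using assms null_0 by (simp add: cauchy_class_def)
  ultimately show "null_seq \<nu> (\<lambda>n. s n - t n)" by (simp add: cauchy_class_def)
next
  assume "null_seq \<nu> (\<lambda>n. s n - t n)"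
  then show "cauchy_class \<nu> s = cauchy_class \<nu> t"
    unfolding cauchy_class_def using null_trans null_commute by blast
qed

lemma some_rep:
  assumes "cauchy_seq \<nu> s"
  shows "cauchy_seq \<nu> (some_rep (cauchy_class \<nu> s))"
    and "null_seq \<nu> (\<lambda>n. some_rep (cauchy_class \<nu> s) n - s n)"
proof -
  have "s \<in> cauchy_class \<nu> s" using assms null_0 by (simp add: cauchy_class_def)
  then have "some_rep (cauchy_class \<nu> s) \<in> cauchy_class \<nu> s"
    unfolding some_rep_def by (metis someI)
  then show "cauchy_seq \<nu> (some_rep (cauchy_class \<nu> s))"
    "null_seq \<nu> (\<lambda>n. some_rep (cauchy_class \<nu> s) n - s n)"
    by (auto simp: cauchy_class_def)
qed

lemma completion_carrier: "X \<in> carrier (cstar_completion \<nu>) \<longleftrightarrow> (\<exists>s. cauchy_seq \<nu> s \<and> X = cauchy_class \<nu> s)"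
  by (auto simp: cstar_completion_def)

lemma class_carrier: "cauchy_seq \<nu> s \<Longrightarrow> cauchy_class \<nu> s \<in> carrier (cstar_completion \<nu>)"
  by (auto simp: completion_carrier)

lemma carrierE:
  assumes "X \<in> carrier (cstar_completion \<nu>)"
  obtains s where "cauchy_seq \<nu> s" "X = cauchy_class \<nu> s"
  using assms by (auto simp: completion_carrier)

lemma completion_one: "\<one>\<^bsub>cstar_completion \<nu>\<^esub> = cauchy_class \<nu> (\<lambda>n. 1)"
  and completion_zero: "\<zero>\<^bsub>cstar_completion \<nu>\<^esub> = cauchy_class \<nu> (\<lambda>n. 0)"
  by (simp_all add: cstar_completion_def)

lemma completion_add:
  assumes s: "cauchy_seq \<nu> s" and t: "cauchy_seq \<nu> t"
  shows "cauchy_class \<nu> s \<oplus>\<^bsub>cstar_completion \<nu>\<^esub> cauchy_class \<nu> t = cauchy_class \<nu> (\<lambda>n. s n + t n)"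
proof -
  let ?s = "some_rep (cauchy_class \<nu> s)" and ?t = "some_rep (cauchy_class \<nu> t)"
  have "null_seq \<nu> (\<lambda>n. (?s n + ?t n) - (s n + t n))"
    using null_add[OF some_rep(2)[OF s] some_rep(2)[OF t]] by (simp add: algebra_simps)
  then show ?thesis
    using s t by (simp add: cstar_completion_def class_eq cauchy_add some_rep(1))
qed

lemma completion_mult:
  assumes s: "cauchy_seq \<nu> s" and t: "cauchy_seq \<nu> t"
  shows "cauchy_class \<nu> s \<otimes>\<^bsub>cstar_completion \<nu>\<^esub> cauchy_class \<nu> t = cauchy_class \<nu> (\<lambda>n. s n * t n)"
proof -
  let ?s = "some_rep (cauchy_class \<nu> s)" and ?t = "some_rep (cauchy_class \<nu> t)"
  obtain B where B: "0 < B" "\<And>n. \<nu> (?s n) \<le> B" using cauchy_bounded[OF some_rep(1)[OF s]] by blast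
  obtain C where C: "0 < C" "\<And>n. \<nu> (t n) \<le> C" using cauchy_bounded[OF t] by blast
  have "null_seq \<nu> (\<lambda>n. ?s n * ?t n - s n * t n)"
  proof (rule nullI)
    fix n
    have "\<nu> (?s n) * \<nu> (?t n - t n) \<le> B * \<nu> (?t n - t n)"
      using B(2) by (rule mult_right_mono) (rule sn_nonneg)
    moreover have "\<nu> (?s n - s n) * \<nu> (t n) \<le> \<nu> (?s n - s n) * C"
      using C(2) by (rule mult_left_mono) (rule sn_nonneg)
    ultimately show "\<nu> (?s n * ?t n - s n * t n) \<le> B * \<nu> (?t n - t n) + \<nu> (?s n - s n) * C"
      using sn_mult_diff[of "?s n" "?t n" "s n" "t n"] by simp
  next
    show "(\<lambda>n. B * \<nu> (?t n - t n) + \<nu> (?s n - s n) * C) \<longlonglongrightarrow> 0"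
      using some_rep(2)[OF s] some_rep(2)[OF t] unfolding null_seq_def
      by (auto intro!: tendsto_eq_intros)
  qed
  then show ?thesis
    using s t by (simp add: cstar_completion_def class_eq cauchy_mult some_rep(1))
qed

lemma completion_cscale:
  assumes s: "cauchy_seq \<nu> s"
  shows "cscale (cstar_completion \<nu>) c (cauchy_class \<nu> s) = cauchy_class \<nu> (\<lambda>n. scale c (s n))"
proof -
  let ?s = "some_rep (cauchy_class \<nu> s)"
  have "null_seq \<nu> (\<lambda>n. scale c (?s n) - scale c (s n))"
    using some_rep(2)[OF s] unfolding null_seq_def
    by (auto simp: sn_scale simp flip: scale_diff intro!: tendsto_eq_intros)
  then show ?thesis
    using s by (simp add: cstar_completion_def class_eq cauchy_scale some_rep(1))
qed

lemma completion_cadj: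
  assumes s: "cauchy_seq \<nu> s"
  shows "cadj (cstar_completion \<nu>) (cauchy_class \<nu> s) = cauchy_class \<nu> (\<lambda>n. star (s n))"
proof -
  let ?s = "some_rep (cauchy_class \<nu> s)"
  have "null_seq \<nu> (\<lambda>n. star (?s n) - star (s n))"
    using some_rep(2)[OF s] unfolding null_seq_def by (simp add: sn_star flip: star_diff)
  then show ?thesis
    using s by (simp add: cstar_completion_def class_eq cauchy_star some_rep(1))
qed

lemma completion_cnorm:
  assumes s: "cauchy_seq \<nu> s"
  shows "(\<lambda>n. \<nu> (s n)) \<longlonglongrightarrow> cnorm (cstar_completion \<nu>) (cauchy_class \<nu> s)"
proof -
  let ?s = "some_rep (cauchy_class \<nu> s)"
  have 1: "(\<lambda>n. \<nu> (?s n)) \<longlonglongrightarrow> lim (\<lambda>n. \<nu> (?s n))"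
    using cauchy_norm_convergent[OF some_rep(1)[OF s]] by (simp add: convergent_LIMSEQ_iff)
  have "(\<lambda>n. \<nu> (s n) - \<nu> (?s n)) \<longlonglongrightarrow> 0"
  proof (rule Lim_null_comparison)
    show "(\<lambda>n. \<nu> (?s n - s n)) \<longlonglongrightarrow> 0" using some_rep(2)[OF s] by (simp add: null_seq_def)
    show "\<forall>\<^sub>F n in sequentially. norm (\<nu> (s n) - \<nu> (?s n)) \<le> \<nu> (?s n - s n)"
    proof (intro always_eventually allI)
      show "norm (\<nu> (s n) - \<nu> (?s n)) \<le> \<nu> (?s n - s n)" for n
        using sn_abs[of "s n" "?s n"] by (simp add: sn_commute[of "s n"])
    qed
  qed
  then have "(\<lambda>n. \<nu> (s n)) \<longlonglongrightarrow> lim (\<lambda>n. \<nu> (?s n))"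
    using tendsto_add[OF _ 1, of "\<lambda>n. \<nu> (s n) - \<nu> (?s n)" 0] by simp
  then show ?thesis by (simp add: cstar_completion_def)
qed

lemma cnorm_class_const: "cnorm (cstar_completion \<nu>) (cauchy_class \<nu> (\<lambda>n. x)) = \<nu> x"
  using completion_cnorm[OF cauchy_const] tendsto_const LIMSEQ_unique by blast

lemma cauchy_uminus: "cauchy_seq \<nu> s \<Longrightarrow> cauchy_seq \<nu> (\<lambda>n. - s n)"
  using cauchy_scale[of s "-1"] by (simp add: scale_uminus_1)

lemma cauchy_diff: "cauchy_seq \<nu> s \<Longrightarrow> cauchy_seq \<nu> t \<Longrightarrow> cauchy_seq \<nu> (\<lambda>n. s n - t n)"
  using cauchy_add[OF _ cauchy_uminus] by simp

lemmas completion_simps = completion_one completion_zero completion_add completion_mult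
  completion_cscale completion_cadj cauchy_intros

lemma completion_ring: "ring (cstar_completion \<nu>)"
proof (rule ringI)
  show "abelian_group (cstar_completion \<nu>)"
  proof (rule abelian_groupI)
    fix X assume "X \<in> carrier (cstar_completion \<nu>)"
    then obtain s where s: "cauchy_seq \<nu> s" "X = cauchy_class \<nu> s" by (auto simp: completion_carrier)
    then show "\<exists>Y\<in>carrier (cstar_completion \<nu>). Y \<oplus>\<^bsub>cstar_completion \<nu>\<^esub> X = \<zero>\<^bsub>cstar_completion \<nu>\<^esub>"
      by (intro bexI[of _ "cauchy_class \<nu> (\<lambda>n. - s n)"])
         (auto simp: completion_simps cauchy_uminus class_carrier)
  qed (auto elim!: carrierE simp: completion_simps add_ac intro!: class_carrier cauchy_intros cauchy_uminus)
  show "monoid (cstar_completion \<nu>)"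
    by (rule monoidI) (auto elim!: carrierE simp: completion_simps mult.assoc intro!: class_carrier cauchy_intros cauchy_uminus)
qed (auto elim!: carrierE simp: completion_simps distrib_left distrib_right intro!: class_carrier cauchy_intros cauchy_uminus)

lemma completion_minus:
  assumes s: "cauchy_seq \<nu> s" and t: "cauchy_seq \<nu> t"
  shows "cauchy_class \<nu> s \<ominus>\<^bsub>cstar_completion \<nu>\<^esub> cauchy_class \<nu> t = cauchy_class \<nu> (\<lambda>n. s n - t n)"
proof -
  interpret ring "cstar_completion \<nu>" by (rule completion_ring)
  have "\<ominus>\<^bsub>cstar_completion \<nu>\<^esub> cauchy_class \<nu> t = cauchy_class \<nu> (\<lambda>n. - t n)"
    by (rule minus_equality)
       (use t in \<open>auto simp: completion_simps cauchy_uminus intro!: class_carrier\<close>)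
  then show ?thesis using s t by (simp add: a_minus_def completion_simps cauchy_uminus)
qed

lemma completion_complete:
  assumes X: "\<And>n::nat. X n \<in> carrier (cstar_completion \<nu>)"
    and C: "\<And>e. 0 < e \<Longrightarrow> \<exists>N. \<forall>m\<ge>N. \<forall>n\<ge>N. cnorm (cstar_completion \<nu>) (X m \<ominus>\<^bsub>cstar_completion \<nu>\<^esub> X n) < e"
  shows "\<exists>L\<in>carrier (cstar_completion \<nu>). (\<lambda>n. cnorm (cstar_completion \<nu>) (X n \<ominus>\<^bsub>cstar_completion \<nu>\<^esub> L)) \<longlonglongrightarrow> 0"
proof -
  obtain s where s: "\<And>k. cauchy_seq \<nu> (s k)" "\<And>k. X k = cauchy_class \<nu> (s k)"
    using X unfolding completion_carrier by metis
  have "\<exists>N. \<forall>m\<ge>N. \<forall>n\<ge>N. \<nu> (s k m - s k n) < inverse (real (Suc k))" for k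
    using s(1)[of k] by (simp add: cauchy_seq_def)
  then obtain N where N: "\<And>k m n. N k \<le> m \<Longrightarrow> N k \<le> n \<Longrightarrow> \<nu> (s k m - s k n) < inverse (real (Suc k))"
    by metis
  define t where "t k = s k (N k)" for k
  let ?d = "\<lambda>k l. cnorm (cstar_completion \<nu>) (X k \<ominus>\<^bsub>cstar_completion \<nu>\<^esub> X l)"
  have lim: "(\<lambda>m. \<nu> (s k m - s l m)) \<longlonglongrightarrow> ?d k l" for k l
    using completion_cnorm[OF cauchy_diff[OF s(1)[of k] s(1)[of l]]] by (simp add: s completion_minus)
  have near: "\<nu> (t k - s k m) \<le> inverse (real (Suc k))" if "N k \<le> m" for k m
    using N[of k "N k" m] that by (simp add: t_def less_imp_le)
  have tt: "\<nu> (t k - t l) \<le> inverse (real (Suc k)) + ?d k l + inverse (real (Suc l))" for k l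
  proof (rule LIMSEQ_le_const)
    show "(\<lambda>m. inverse (real (Suc k)) + \<nu> (s k m - s l m) + inverse (real (Suc l)))
        \<longlonglongrightarrow> inverse (real (Suc k)) + ?d k l + inverse (real (Suc l))"
      by (intro tendsto_intros lim)
    show "\<exists>M. \<forall>m\<ge>M. \<nu> (t k - t l) \<le> inverse (real (Suc k)) + \<nu> (s k m - s l m) + inverse (real (Suc l))"
    proof (intro exI[of _ "max (N k) (N l)"] allI impI)
      fix m assume m: "max (N k) (N l) \<le> m"
      have "\<nu> (t k - t l) \<le> \<nu> (t k - s k m) + \<nu> (s k m - t l)" by (rule sn_triangle)
      also have "\<nu> (s k m - t l) \<le> \<nu> (s k m - s l m) + \<nu> (s l m - t l)" by (rule sn_triangle)
      finally show "\<nu> (t k - t l) \<le> inverse (real (Suc k)) + \<nu> (s k m - s l m) + inverse (real (Suc l))"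
        using near[of k m] near[of l m] m sn_commute[of "s l m" "t l"] by simp
    qed
  qed
  have small: "\<exists>K. \<forall>k\<ge>K. \<forall>l\<ge>K. inverse (real (Suc k)) + ?d k l + inverse (real (Suc l)) < e" if e: "0 < e" for e
  proof -
    obtain K where K: "\<And>k l. K \<le> k \<Longrightarrow> K \<le> l \<Longrightarrow> ?d k l < e / 3"
      using C[of "e / 3"] e by (metis divide_pos_pos zero_less_numeral)
    obtain M where M: "inverse (real (Suc M)) < e / 3"
      using reals_Archimedean[of "e / 3"] e by auto
    have M': "inverse (real (Suc k)) < e / 3" if "M \<le> k" for k
    proof -
      have "inverse (real (Suc k)) \<le> inverse (real (Suc M))"
        using that by (intro le_imp_inverse_le) auto
      then show ?thesis using M by linarith
    qed
    show ?thesis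
    proof (intro exI[of _ "max K M"] allI impI)
      fix k l assume "max K M \<le> k" "max K M \<le> l"
      then show "inverse (real (Suc k)) + ?d k l + inverse (real (Suc l)) < e"
        using K[of k l] M'[of k] M'[of l] by simp
    qed
  qed
  have t: "cauchy_seq \<nu> t"
    unfolding cauchy_seq_def using small tt by (meson order_le_less_trans)
  show ?thesis
  proof (intro bexI[of _ "cauchy_class \<nu> t"])
    show "cauchy_class \<nu> t \<in> carrier (cstar_completion \<nu>)" using t by (auto simp: completion_carrier)
    show "(\<lambda>k. cnorm (cstar_completion \<nu>) (X k \<ominus>\<^bsub>cstar_completion \<nu>\<^esub> cauchy_class \<nu> t)) \<longlonglongrightarrow> 0"
    proof (rule LIMSEQ_I)
      fix e :: real assume "0 < e"
      then have e: "0 < e / 2" "0 < e / 3" by auto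
      obtain K where K: "\<And>k l. K \<le> k \<Longrightarrow> K \<le> l \<Longrightarrow>
          inverse (real (Suc k)) + ?d k l + inverse (real (Suc l)) < e / 3"
        using small[OF e(2)] by meson
      show "\<exists>K. \<forall>k\<ge>K. norm (cnorm (cstar_completion \<nu>) (X k \<ominus>\<^bsub>cstar_completion \<nu>\<^esub> cauchy_class \<nu> t) - 0) < e"
      proof (intro exI[of _ K] allI impI)
        fix k assume k: "K \<le> k"
        have L: "(\<lambda>m. \<nu> (s k m - t m)) \<longlonglongrightarrow> cnorm (cstar_completion \<nu>) (X k \<ominus>\<^bsub>cstar_completion \<nu>\<^esub> cauchy_class \<nu> t)"
          using completion_cnorm[OF cauchy_diff[OF s(1)[of k] t]] by (simp add: s t completion_minus)
        have nn: "0 \<le> cnorm (cstar_completion \<nu>) (X k \<ominus>\<^bsub>cstar_completion \<nu>\<^esub> cauchy_class \<nu> t)"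
          by (rule LIMSEQ_le_const[OF L]) (auto simp: sn_nonneg)
        have dn: "0 \<le> ?d k k" by (rule LIMSEQ_le_const[OF lim]) (auto simp: sn_nonneg)
        have inv: "inverse (real (Suc k)) < e / 3"
          using K[OF k k] dn by (smt (verit) inverse_positive_iff_positive of_nat_0_less_iff zero_less_Suc)
        have "cnorm (cstar_completion \<nu>) (X k \<ominus>\<^bsub>cstar_completion \<nu>\<^esub> cauchy_class \<nu> t) \<le> e / 3 + e / 3"
        proof (rule LIMSEQ_le_const2[OF L])
          show "\<exists>M. \<forall>m\<ge>M. \<nu> (s k m - t m) \<le> e / 3 + e / 3"
          proof (intro exI[of _ "max K (N k)"] allI impI)
            fix m assume m: "max K (N k) \<le> m"
            have "\<nu> (s k m - t m) \<le> \<nu> (s k m - t k) + \<nu> (t k - t m)" by (rule sn_triangle)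
            moreover have "\<nu> (s k m - t k) \<le> e / 3"
              using near[of k m] m inv by (simp add: sn_commute)
            moreover have "\<nu> (t k - t m) \<le> e / 3" using tt[of k m] K[of k m] k m by simp
            ultimately show "\<nu> (s k m - t m) \<le> e / 3 + e / 3" by simp
          qed
        qed
        then show "norm (cnorm (cstar_completion \<nu>) (X k \<ominus>\<^bsub>cstar_completion \<nu>\<^esub> cauchy_class \<nu> t) - 0) < e"
          using nn \<open>0 < e\<close> by simp
      qed
    qed
  qed
qed

theorem completion_unital_cstar: "unital_cstar (cstar_completion \<nu>)"
proof (intro unital_cstar.intro unital_cstar_axioms.intro)
  show "ring (cstar_completion \<nu>)" by (rule completion_ring)
next
  fix x assume "x \<in> carrier (cstar_completion \<nu>)"
  then obtain s where s: "cauchy_seq \<nu> s" "x = cauchy_class \<nu> s" by (auto simp: completion_carrier)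
  note L = completion_cnorm[OF s(1)]
  show "0 \<le> cnorm (cstar_completion \<nu>) x"
    using s(2) LIMSEQ_le_const[OF L] sn_nonneg by blast
  show "cnorm (cstar_completion \<nu>) x = 0 \<longleftrightarrow> x = \<zero>\<^bsub>cstar_completion \<nu>\<^esub>"
  proof -
    have "null_seq \<nu> s \<longleftrightarrow> cnorm (cstar_completion \<nu>) (cauchy_class \<nu> s) = 0"
      unfolding null_seq_def using L LIMSEQ_unique by metis
    then show ?thesis using s by (simp add: completion_simps class_eq)
  qed
  show "cnorm (cstar_completion \<nu>) (cscale (cstar_completion \<nu>) c x) = cmod c * cnorm (cstar_completion \<nu>) x" for c
    using LIMSEQ_unique[OF completion_cnorm[OF cauchy_scale[OF s(1), of c]]] tendsto_mult_left[OF L, of "cmod c"]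
    by (simp add: s completion_simps sn_scale)
  show "cnorm (cstar_completion \<nu>) (cadj (cstar_completion \<nu>) x \<otimes>\<^bsub>cstar_completion \<nu>\<^esub> x) = (cnorm (cstar_completion \<nu>) x)\<^sup>2"
    using LIMSEQ_unique[OF completion_cnorm[OF cauchy_mult[OF cauchy_star[OF s(1)] s(1)]]] tendsto_power[OF L, of 2]
    by (simp add: s completion_simps sn_star_mult)
  fix y assume "y \<in> carrier (cstar_completion \<nu>)"
  then obtain t where t: "cauchy_seq \<nu> t" "y = cauchy_class \<nu> t" by (auto simp: completion_carrier)
  note M = completion_cnorm[OF t(1)]
  have "cnorm (cstar_completion \<nu>) (cauchy_class \<nu> (\<lambda>n. s n + t n))
      \<le> cnorm (cstar_completion \<nu>) (cauchy_class \<nu> s) + cnorm (cstar_completion \<nu>) (cauchy_class \<nu> t)"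
    using LIMSEQ_le[OF completion_cnorm[OF cauchy_add[OF s(1) t(1)]] tendsto_add[OF L M]] sn_add by blast
  then show "cnorm (cstar_completion \<nu>) (x \<oplus>\<^bsub>cstar_completion \<nu>\<^esub> y) \<le> cnorm (cstar_completion \<nu>) x + cnorm (cstar_completion \<nu>) y"
    by (simp add: s t completion_simps)
  have "cnorm (cstar_completion \<nu>) (cauchy_class \<nu> (\<lambda>n. s n * t n))
      \<le> cnorm (cstar_completion \<nu>) (cauchy_class \<nu> s) * cnorm (cstar_completion \<nu>) (cauchy_class \<nu> t)"
    using LIMSEQ_le[OF completion_cnorm[OF cauchy_mult[OF s(1) t(1)]] tendsto_mult[OF L M]] sn_mult by blast
  then show "cnorm (cstar_completion \<nu>) (x \<otimes>\<^bsub>cstar_completion \<nu>\<^esub> y) \<le> cnorm (cstar_completion \<nu>) x * cnorm (cstar_completion \<nu>) y"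
    by (simp add: s t completion_simps)
next
  fix X assume "\<And>n::nat. X n \<in> carrier (cstar_completion \<nu>)"
    "\<And>e. 0 < e \<Longrightarrow> \<exists>N. \<forall>m\<ge>N. \<forall>n\<ge>N. cnorm (cstar_completion \<nu>) (X m \<ominus>\<^bsub>cstar_completion \<nu>\<^esub> X n) < e"
  then show "\<exists>L\<in>carrier (cstar_completion \<nu>). (\<lambda>n. cnorm (cstar_completion \<nu>) (X n \<ominus>\<^bsub>cstar_completion \<nu>\<^esub> L)) \<longlonglongrightarrow> 0"
    by (rule completion_complete)
qed (auto elim!: carrierE simp: completion_simps scale_add scale_plus scale_scale star_add star_scale
      star_mult simp flip: scale_mult_left scale_mult_right intro!: class_carrier cauchy_intros)

end


subsection \<open>The universal property\<close>

lemma max_seminorm_upper: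
  assumes "bounded_relations R" "\<nu> \<in> admissible R"
  shows "\<nu> x \<le> max_seminorm R x"
  using assms unfolding max_seminorm_def bounded_relations_def by (auto intro: cSUP_upper)

lemma admissible_zero: "(\<lambda>x. 0) \<in> admissible R"
  by (simp add: admissible_def cstar_seminorm_def)

lemma max_seminorm_least: "(\<And>\<nu>. \<nu> \<in> admissible R \<Longrightarrow> \<nu> x \<le> b) \<Longrightarrow> max_seminorm R x \<le> b"
  unfolding max_seminorm_def using admissible_zero by (intro cSUP_least) auto

lemma max_seminorm_admissible:
  assumes B: "bounded_relations R"
  shows "max_seminorm R \<in> admissible R"
proof -
  note up = max_seminorm_upper[OF B]
  have sn: "cstar_seminorm \<nu>" if "\<nu> \<in> admissible R" for \<nu> using that by (simp add: admissible_def)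
  have nn: "0 \<le> max_seminorm R x" for x using up[OF admissible_zero] by simp
  have "max_seminorm R (x + y) \<le> max_seminorm R x + max_seminorm R y" for x y
    by (rule max_seminorm_least) (meson add_mono order_trans sn sn_add up)
  moreover have mult: "max_seminorm R (x * y) \<le> max_seminorm R x * max_seminorm R y" for x y
    by (rule max_seminorm_least) (meson mult_mono nn order_trans sn sn_mult sn_nonneg up)
  moreover have le: "max_seminorm R (scale c x) \<le> cmod c * max_seminorm R x" for c x
    by (rule max_seminorm_least) (simp add: mult_left_mono sn sn_scale up)
  have "max_seminorm R (scale c x) = cmod c * max_seminorm R x" for c x
  proof (cases "c = 0")
    case True
    then show ?thesis using le[of c x] nn[of "scale c x"] by simp
  next
    case False
    have "max_seminorm R x \<le> cmod (inverse c) * max_seminorm R (scale c x)"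
      using le[of "inverse c" "scale c x"] False by (simp add: scale_scale)
    then have "cmod c * max_seminorm R x \<le> max_seminorm R (scale c x)"
      using False by (simp add: norm_divide field_simps)
    then show ?thesis using le[of c x] by simp
  qed
  moreover have "max_seminorm R (star x * x) = (max_seminorm R x)\<^sup>2" for x
  proof (rule antisym)
    have "\<nu> (star x * x) \<le> (max_seminorm R x)\<^sup>2" if "\<nu> \<in> admissible R" for \<nu>
      using that by (simp add: sn sn_star_mult sn_nonneg power_mono up)
    then show "max_seminorm R (star x * x) \<le> (max_seminorm R x)\<^sup>2" by (rule max_seminorm_least)
    have "\<nu> x \<le> sqrt (max_seminorm R (star x * x))" if "\<nu> \<in> admissible R" for \<nu>
      using that up[OF that, of "star x * x"] by (intro real_le_rsqrt) (simp add: sn sn_star_mult)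
    then have "max_seminorm R x \<le> sqrt (max_seminorm R (star x * x))" by (rule max_seminorm_least)
    then show "(max_seminorm R x)\<^sup>2 \<le> max_seminorm R (star x * x)"
      using nn by (metis power_mono real_sqrt_pow2)
  qed
  moreover have "max_seminorm R (a - b) = 0" if "(a, b) \<in> R" for a b
  proof (rule antisym[OF _ nn])
    show "max_seminorm R (a - b) \<le> 0"
      using that by (intro max_seminorm_least) (auto simp: admissible_def)
  qed
  ultimately show ?thesis by (auto simp: admissible_def cstar_seminorm_def)
qed

lemma max_seminorm_cstar: "bounded_relations R \<Longrightarrow> cstar_seminorm (max_seminorm R)"
  using max_seminorm_admissible by (auto simp: admissible_def)

theorem universal_cstar_unital_cstar: "bounded_relations R \<Longrightarrow> unital_cstar (universal_cstar R)"
  unfolding universal_cstar_def by (intro completion_unital_cstar max_seminorm_cstar)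

theorem universal_map_star_rep: "bounded_relations R \<Longrightarrow> star_rep (universal_cstar R) (universal_map R)"
  unfolding star_rep_def universal_cstar_def universal_map_def
  using max_seminorm_cstar by (auto simp: completion_simps intro!: class_carrier cauchy_intros)

theorem universal_map_relations:
  assumes "bounded_relations R" "(a, b) \<in> R"
  shows "universal_map R a = universal_map R b"
proof -
  have "max_seminorm R (a - b) = 0"
    using max_seminorm_admissible[OF assms(1)] assms(2) by (auto simp: admissible_def)
  then show ?thesis
    unfolding universal_map_def using max_seminorm_cstar[OF assms(1)]
    by (simp add: class_eq cauchy_const null_seq_def)
qed

context unital_cstar
begin

lemma cnorm_zero: "cnorm A \<zero> = 0"
  using cnorm_eq_0 by simp

lemma cscale_0: "x \<in> carrier A \<Longrightarrow> cscale A 0 x = \<zero>"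
  using cnorm_cscale[of x 0] cnorm_eq_0 cscale_closed by simp

lemma cscale_minus_1: "x \<in> carrier A \<Longrightarrow> cscale A (-1) x = \<ominus> x"
  using cscale_plus[of x "-1" 1] cscale_0[of x] cscale_one[of x] cscale_closed
  by (metis add.left_inverse minus_equality)

lemma cnorm_uminus: "x \<in> carrier A \<Longrightarrow> cnorm A (\<ominus> x) = cnorm A x"
  by (simp add: cnorm_cscale flip: cscale_minus_1)

lemma cscale_minus:
  assumes "x \<in> carrier A" "y \<in> carrier A"
  shows "cscale A c (x \<ominus> y) = cscale A c x \<ominus> cscale A c y"
  using assms by (simp add: a_minus_def cscale_add cscale_cscale cscale_closed flip: cscale_minus_1)

lemma cadj_minus:
  assumes "x \<in> carrier A" "y \<in> carrier A"
  shows "cadj A (x \<ominus> y) = cadj A x \<ominus> cadj A y"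
  using assms by (simp add: a_minus_def cadj_add cadj_cscale cscale_closed cadj_closed flip: cscale_minus_1)

lemma cnorm_cadj_le: "x \<in> carrier A \<Longrightarrow> cnorm A x \<le> cnorm A (cadj A x)"
proof -
  assume x: "x \<in> carrier A"
  show ?thesis
  proof (cases "cnorm A x = 0")
    case False
    then have "0 < cnorm A x" using cnorm_nonneg[OF x] by simp
    moreover have "cnorm A x * cnorm A x \<le> cnorm A (cadj A x) * cnorm A x"
      using cnorm_mult[OF cadj_closed[OF x] x] by (simp add: cstar_identity[OF x] power2_eq_square)
    ultimately show ?thesis by simp
  qed (simp add: cnorm_nonneg cadj_closed x)
qed

lemma cnorm_cadj: "x \<in> carrier A \<Longrightarrow> cnorm A (cadj A x) = cnorm A x"
  using cnorm_cadj_le[of x] cnorm_cadj_le[of "cadj A x"] by (simp add: cadj_cadj cadj_closed)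

lemma cnorm_minus_commute:
  assumes "x \<in> carrier A" "y \<in> carrier A"
  shows "cnorm A (x \<ominus> y) = cnorm A (y \<ominus> x)"
proof -
  have "x \<ominus> y = \<ominus> (y \<ominus> x)" using assms by (simp add: a_minus_def minus_add a_comm)
  then show ?thesis using assms by (simp add: cnorm_uminus)
qed

lemma cnorm_minus_triangle:
  assumes "x \<in> carrier A" "y \<in> carrier A" "z \<in> carrier A"
  shows "cnorm A (x \<ominus> z) \<le> cnorm A (x \<ominus> y) + cnorm A (y \<ominus> z)"
proof -
  have "x \<ominus> z = (x \<ominus> y) \<oplus> (y \<ominus> z)"
    using assms by (simp add: a_minus_def a_assoc l_neg r_neg1 r_neg2)
  then show ?thesis using cnorm_triangle[of "x \<ominus> y" "y \<ominus> z"] assms by simp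
qed

definition conv :: "(nat \<Rightarrow> 'a) \<Rightarrow> 'a \<Rightarrow> bool" where
  "conv s L \<longleftrightarrow> (\<forall>n. s n \<in> carrier A) \<and> L \<in> carrier A \<and> (\<lambda>n. cnorm A (s n \<ominus> L)) \<longlonglongrightarrow> 0"

lemma convI:
  assumes "\<And>n. s n \<in> carrier A" "L \<in> carrier A" "\<And>n. cnorm A (s n \<ominus> L) \<le> f n" "f \<longlonglongrightarrow> 0"
  shows "conv s L"
  unfolding conv_def using assms
  by (auto intro!: tendsto_sandwich[of "\<lambda>_. 0" "\<lambda>n. cnorm A (s n \<ominus> L)" sequentially f] simp: cnorm_nonneg)

lemma convD:
  assumes "conv s L"
  shows "s n \<in> carrier A" "L \<in> carrier A" "(\<lambda>n. cnorm A (s n \<ominus> L)) \<longlonglongrightarrow> 0"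
  using assms by (auto simp: conv_def)

lemma conv_unique:
  assumes "conv s L" "conv s M"
  shows "L = M"
proof -
  note c = convD[OF assms(1)] convD[OF assms(2)]
  have "(\<lambda>n. cnorm A (s n \<ominus> L) + cnorm A (s n \<ominus> M)) \<longlonglongrightarrow> 0 + 0"
    by (intro tendsto_add c)
  moreover have "cnorm A (L \<ominus> M) \<le> cnorm A (s n \<ominus> L) + cnorm A (s n \<ominus> M)" for n
    using cnorm_minus_triangle[of L "s n" M] c by (simp add: cnorm_minus_commute[of L])
  ultimately have "cnorm A (L \<ominus> M) \<le> 0 + 0" by (intro LIMSEQ_le_const) auto
  then have "cnorm A (L \<ominus> M) = 0" using cnorm_nonneg[of "L \<ominus> M"] c by simp
  then have "L \<ominus> M = \<zero>" using cnorm_eq_0[of "L \<ominus> M"] c by simp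
  moreover have "L = (L \<ominus> M) \<oplus> M" using c by (simp add: a_minus_def a_assoc l_neg)
  ultimately show ?thesis using c by simp
qed

lemma conv_const: "x \<in> carrier A \<Longrightarrow> conv (\<lambda>n. x) x"
  by (rule convI[of _ _ "\<lambda>n. 0"]) (auto simp: cnorm_zero a_minus_def r_neg)

lemma conv_add:
  assumes "conv s L" "conv t M"
  shows "conv (\<lambda>n. s n \<oplus> t n) (L \<oplus> M)"
proof (rule convI)
  note c = convD[OF assms(1)] convD[OF assms(2)]
  show "s n \<oplus> t n \<in> carrier A" "L \<oplus> M \<in> carrier A" for n using c by auto
  show "cnorm A ((s n \<oplus> t n) \<ominus> (L \<oplus> M)) \<le> cnorm A (s n \<ominus> L) + cnorm A (t n \<ominus> M)" for n
  proof -
    have "(s n \<oplus> t n) \<ominus> (L \<oplus> M) = (s n \<ominus> L) \<oplus> (t n \<ominus> M)"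
      using c by (simp add: a_minus_def minus_add a_ac)
    then show ?thesis using cnorm_triangle[of "s n \<ominus> L" "t n \<ominus> M"] c by simp
  qed
  show "(\<lambda>n. cnorm A (s n \<ominus> L) + cnorm A (t n \<ominus> M)) \<longlonglongrightarrow> 0"
    using c by (auto intro!: tendsto_eq_intros)
qed

lemma conv_cscale: "conv s L \<Longrightarrow> conv (\<lambda>n. cscale A c (s n)) (cscale A c L)"
  unfolding conv_def
  by (auto simp: cscale_closed cnorm_cscale simp flip: cscale_minus intro!: tendsto_eq_intros)

lemma conv_cadj: "conv s L \<Longrightarrow> conv (\<lambda>n. cadj A (s n)) (cadj A L)"
  unfolding conv_def by (auto simp: cadj_closed cnorm_cadj simp flip: cadj_minus)

lemma conv_mult:
  assumes "conv s L" "conv t M"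
  shows "conv (\<lambda>n. s n \<otimes> t n) (L \<otimes> M)"
proof (rule convI)
  note c = convD[OF assms(1)] convD[OF assms(2)]
  show "s n \<otimes> t n \<in> carrier A" "L \<otimes> M \<in> carrier A" for n using c by auto
  show "cnorm A ((s n \<otimes> t n) \<ominus> (L \<otimes> M))
      \<le> (cnorm A (s n \<ominus> L) + cnorm A L) * cnorm A (t n \<ominus> M) + cnorm A (s n \<ominus> L) * cnorm A M" for n
  proof -
    have sn: "s n \<in> carrier A" and tn: "t n \<in> carrier A" and LM: "L \<in> carrier A" "M \<in> carrier A"
      using c by auto
    have "cnorm A (s n) \<le> cnorm A (s n \<ominus> L) + cnorm A L"
    proof -
      have "s n = (s n \<ominus> L) \<oplus> L" using sn LM by (simp add: a_minus_def a_assoc l_neg)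
      then show ?thesis using cnorm_triangle[of "s n \<ominus> L" L] sn LM by simp
    qed
    then have 1: "cnorm A (s n \<otimes> (t n \<ominus> M)) \<le> (cnorm A (s n \<ominus> L) + cnorm A L) * cnorm A (t n \<ominus> M)"
      using cnorm_mult[of "s n" "t n \<ominus> M"] cnorm_nonneg[of "t n \<ominus> M"] sn tn LM
      by (meson minus_closed mult_right_mono order_trans)
    have 2: "cnorm A ((s n \<ominus> L) \<otimes> M) \<le> cnorm A (s n \<ominus> L) * cnorm A M"
      using cnorm_mult[of "s n \<ominus> L" M] sn LM by simp
    have "(s n \<otimes> t n) \<ominus> (L \<otimes> M) = s n \<otimes> (t n \<ominus> M) \<oplus> (s n \<ominus> L) \<otimes> M"
    proof -
      have "s n \<otimes> (t n \<ominus> M) \<oplus> (s n \<ominus> L) \<otimes> M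
          = s n \<otimes> t n \<oplus> (\<ominus> (s n \<otimes> M) \<oplus> (s n \<otimes> M \<oplus> \<ominus> (L \<otimes> M)))"
        using sn tn LM by (simp add: a_minus_def r_distr l_distr r_minus l_minus a_assoc)
      also have "\<dots> = (s n \<otimes> t n) \<ominus> (L \<otimes> M)" using sn tn LM by (simp add: a_minus_def r_neg1)
      finally show ?thesis by simp
    qed
    then show ?thesis
      using 1 2 cnorm_triangle[of "s n \<otimes> (t n \<ominus> M)" "(s n \<ominus> L) \<otimes> M"] sn tn LM by simp
  qed
  show "(\<lambda>n. (cnorm A (s n \<ominus> L) + cnorm A L) * cnorm A (t n \<ominus> M) + cnorm A (s n \<ominus> L) * cnorm A M) \<longlonglongrightarrow> 0"
    using c by (auto intro!: tendsto_eq_intros)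
qed

lemma conv_cnorm:
  assumes "conv s L"
  shows "(\<lambda>n. cnorm A (s n)) \<longlonglongrightarrow> cnorm A L"
proof -
  note c = convD[OF assms]
  have z: "cnorm A x = cnorm A (x \<ominus> \<zero>)" if "x \<in> carrier A" for x
    using that by (simp add: a_minus_def)
  have "\<bar>cnorm A (s n) - cnorm A L\<bar> \<le> cnorm A (s n \<ominus> L)" for n
    using cnorm_minus_triangle[OF c(1)[of n] c(2) zero_closed] cnorm_minus_triangle[OF c(2) c(1)[of n] zero_closed]
      z[OF c(1)[of n]] z[OF c(2)] cnorm_minus_commute[OF c(2) c(1)[of n]] by linarith
  then have "(\<lambda>n. cnorm A (s n) - cnorm A L) \<longlonglongrightarrow> 0"
    by (intro Lim_null_comparison[OF _ c(3)] always_eventually) simp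
  then show ?thesis by (simp add: LIM_zero_iff)
qed

end

lemma star_rep_minus:
  assumes "unital_cstar B" "star_rep B \<pi>"
  shows "\<pi> (x - y) = \<pi> x \<ominus>\<^bsub>B\<^esub> \<pi> y"
proof -
  interpret B: unital_cstar B by fact
  have "\<pi> (x + scale (-1) y) = \<pi> x \<oplus>\<^bsub>B\<^esub> cscale B (-1) (\<pi> y)"
    using assms(2) by (simp add: star_rep_def)
  then show ?thesis
    using assms(2) by (simp add: scale_uminus_1 B.cscale_minus_1 a_minus_def star_rep_def)
qed

lemma star_rep_seminorm:
  assumes "unital_cstar B" "star_rep B \<pi>"
  shows "cstar_seminorm (\<lambda>x. cnorm B (\<pi> x))"
proof -
  interpret B: unital_cstar B by fact
  show ?thesis
    using assms(2)
    by (simp add: cstar_seminorm_def star_rep_def B.cnorm_triangle B.cnorm_mult B.cnorm_cscale B.cstar_identity)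
qed

lemma star_rep_bound:
  assumes R: "bounded_relations R" and B: "unital_cstar B" and \<pi>: "star_rep B \<pi>"
    and rel: "\<And>a b. (a, b) \<in> R \<Longrightarrow> \<pi> a = \<pi> b"
  shows "cnorm B (\<pi> x) \<le> max_seminorm R x"
proof -
  interpret B: unital_cstar B by fact
  have "cnorm B (\<pi> (a - b)) = 0" if "(a, b) \<in> R" for a b
    using rel[OF that] \<pi> by (simp add: star_rep_minus[OF B \<pi>] a_minus_def B.r_neg B.cnorm_zero star_rep_def)
  then have "(\<lambda>x. cnorm B (\<pi> x)) \<in> admissible R"
    using star_rep_seminorm[OF B \<pi>] by (auto simp: admissible_def)
  then show ?thesis by (rule max_seminorm_upper[OF R])
qed

text \<open>The factorisation is unique because *-homomorphisms are contractive and the image of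
  \<open>universal_map R\<close> is dense.\<close>

theorem universal_property:
  assumes R: "bounded_relations R" and B: "unital_cstar B" and \<pi>: "star_rep B \<pi>"
    and rel: "\<And>a b. (a, b) \<in> R \<Longrightarrow> \<pi> a = \<pi> b"
  shows "\<exists>\<phi>\<in>cstar_hom (universal_cstar R) B. \<forall>x. \<phi> (universal_map R x) = \<pi> x"
proof -
  interpret B: unital_cstar B by fact
  define \<nu> where "\<nu> = max_seminorm R"
  have sn: "cstar_seminorm \<nu>" using max_seminorm_cstar[OF R] by (simp add: \<nu>_def)
  have bound: "cnorm B (\<pi> x) \<le> \<nu> x" for x
    using star_rep_bound[OF assms] by (simp add: \<nu>_def)
  have \<pi>c: "\<pi> x \<in> carrier B" for x using \<pi> by (simp add: star_rep_def)
  note minus = star_rep_minus[OF B \<pi>]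
  have ex: "\<exists>L. B.conv (\<lambda>n. \<pi> (s n)) L" if s: "cauchy_seq \<nu> s" for s
  proof -
    have "\<exists>N. \<forall>m\<ge>N. \<forall>n\<ge>N. cnorm B (\<pi> (s m) \<ominus>\<^bsub>B\<^esub> \<pi> (s n)) < e" if "0 < e" for e
      using s that bound unfolding cauchy_seq_def minus[symmetric] by (meson order_le_less_trans)
    then show ?thesis
      using B.complete[of "\<lambda>n. \<pi> (s n)"] \<pi>c by (auto simp: B.conv_def)
  qed
  define \<phi> where "\<phi> X = (SOME L. B.conv (\<lambda>n. \<pi> (some_rep X n)) L)" for X
  have \<phi>: "B.conv (\<lambda>n. \<pi> (s n)) (\<phi> (cauchy_class \<nu> s))" if s: "cauchy_seq \<nu> s" for s
  proof -
    let ?t = "some_rep (cauchy_class \<nu> s)" and ?L = "\<phi> (cauchy_class \<nu> s)"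
    have c: "B.conv (\<lambda>n. \<pi> (?t n)) ?L"
      unfolding \<phi>_def using ex[OF some_rep(1)[OF sn s]] by (rule someI_ex)
    note cD = B.convD[OF c]
    show ?thesis
    proof (rule B.convI)
      show "cnorm B (\<pi> (s n) \<ominus>\<^bsub>B\<^esub> ?L) \<le> \<nu> (?t n - s n) + cnorm B (\<pi> (?t n) \<ominus>\<^bsub>B\<^esub> ?L)" for n
        using B.cnorm_minus_triangle[OF \<pi>c[of "s n"] \<pi>c[of "?t n"] cD(2)] bound[of "s n - ?t n"]
        by (simp add: minus sn_commute[OF sn, of "?t n"])
      show "(\<lambda>n. \<nu> (?t n - s n) + cnorm B (\<pi> (?t n) \<ominus>\<^bsub>B\<^esub> ?L)) \<longlonglongrightarrow> 0"
        using cD(3) some_rep(2)[OF sn s] unfolding null_seq_def by (auto intro!: tendsto_eq_intros)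
    qed (use \<pi>c cD in auto)
  qed
  note C = completion_carrier[OF sn] and S = completion_simps[OF sn]
  have const: "\<phi> (cauchy_class \<nu> (\<lambda>n. x)) = \<pi> x" for x
    using B.conv_unique[OF \<phi>[OF cauchy_const[OF sn]] B.conv_const[OF \<pi>c]] .
  have "\<phi> \<in> cstar_hom (cstar_completion \<nu>) B"
    unfolding cstar_hom_def
  proof (intro CollectI conjI allI ballI)
    show "\<phi> \<in> ring_hom (cstar_completion \<nu>) B"
    proof (rule ring_hom_memI)
      fix X assume "X \<in> carrier (cstar_completion \<nu>)"
      then obtain s where s: "cauchy_seq \<nu> s" "X = cauchy_class \<nu> s" by (auto simp: C)
      show "\<phi> X \<in> carrier B" using B.convD[OF \<phi>[OF s(1)]] s by simp
      fix Y assume "Y \<in> carrier (cstar_completion \<nu>)"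
      then obtain t where t: "cauchy_seq \<nu> t" "Y = cauchy_class \<nu> t" by (auto simp: C)
      show "\<phi> (X \<otimes>\<^bsub>cstar_completion \<nu>\<^esub> Y) = \<phi> X \<otimes>\<^bsub>B\<^esub> \<phi> Y"
        using B.conv_unique[OF \<phi>[OF cauchy_mult[OF sn s(1) t(1)]]] B.conv_mult[OF \<phi>[OF s(1)] \<phi>[OF t(1)]] \<pi>
        by (simp add: s t S star_rep_def)
      show "\<phi> (X \<oplus>\<^bsub>cstar_completion \<nu>\<^esub> Y) = \<phi> X \<oplus>\<^bsub>B\<^esub> \<phi> Y"
        using B.conv_unique[OF \<phi>[OF cauchy_add[OF sn s(1) t(1)]]] B.conv_add[OF \<phi>[OF s(1)] \<phi>[OF t(1)]] \<pi>
        by (simp add: s t S star_rep_def)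
    next
      show "\<phi> \<one>\<^bsub>cstar_completion \<nu>\<^esub> = \<one>\<^bsub>B\<^esub>"
        using const[of 1] \<pi> by (simp add: S star_rep_def)
    qed
  next
    fix c X assume "X \<in> carrier (cstar_completion \<nu>)"
    then obtain s where s: "cauchy_seq \<nu> s" "X = cauchy_class \<nu> s" by (auto simp: C)
    show "\<phi> (cscale (cstar_completion \<nu>) c X) = cscale B c (\<phi> X)"
      using B.conv_unique[OF \<phi>[OF cauchy_scale[OF sn s(1)]]] B.conv_cscale[OF \<phi>[OF s(1)]] \<pi>
      by (simp add: s S star_rep_def)
  next
    fix X assume "X \<in> carrier (cstar_completion \<nu>)"
    then obtain s where s: "cauchy_seq \<nu> s" "X = cauchy_class \<nu> s" by (auto simp: C)
    show "\<phi> (cadj (cstar_completion \<nu>) X) = cadj B (\<phi> X)"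
      using B.conv_unique[OF \<phi>[OF cauchy_star[OF sn s(1)]]] B.conv_cadj[OF \<phi>[OF s(1)]] \<pi>
      by (simp add: s S star_rep_def)
  qed
  then show ?thesis
    using const by (auto simp: universal_cstar_def universal_map_def \<nu>_def)
qed

lemma bounded_relationsI:
  assumes "\<And>m. \<exists>b. \<forall>\<nu>\<in>admissible R. \<nu> (basis m) \<le> b"
  shows "bounded_relations R"
proof -
  have sn: "cstar_seminorm \<nu>" if "\<nu> \<in> admissible R" for \<nu> using that by (simp add: admissible_def)
  have "\<exists>b. \<forall>\<nu>\<in>admissible R. \<nu> x \<le> b" for x
  proof (induction x rule: star_alg_induct)
    case zero
    then show ?case using sn sn_0 by (metis order_refl)
  next
    case (single m c)
    obtain b where "\<forall>\<nu>\<in>admissible R. \<nu> (basis m) \<le> b" using assms by blast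
    then have "\<forall>\<nu>\<in>admissible R. \<nu> (Poly_Mapping.single m c) \<le> cmod c * b"
      by (simp add: single_eq_scale[of m c] sn sn_scale mult_left_mono)
    then show ?case by blast
  next
    case (add x y)
    then obtain b d where "\<forall>\<nu>\<in>admissible R. \<nu> x \<le> b" "\<forall>\<nu>\<in>admissible R. \<nu> y \<le> d" by blast
    then have "\<forall>\<nu>\<in>admissible R. \<nu> (x + y) \<le> b + d"
      by (meson add_mono order_trans sn sn_add)
    then show ?case by blast
  qed
  then show ?thesis by (auto simp: bounded_relations_def bdd_above_def)
qed

lemma sn_one_le: "cstar_seminorm \<nu> \<Longrightarrow> \<nu> 1 \<le> 1"
proof -
  assume sn: "cstar_seminorm \<nu>"
  have "\<nu> 1 = \<nu> 1 * \<nu> 1" using sn_star_mult[OF sn, of 1] by (simp add: power2_eq_square)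
  then show ?thesis by (metis dual_order.refl mult_cancel_right1 zero_le_one)
qed

section \<open>Free monoid with involution and free group\<close>

text \<open>Words in letters \<open>x\<close> and \<open>x\<^sup>*\<close>; the Boolean marks the adjoint letters. The associated
  \<open>star_alg\<close> is the free unital *-algebra.\<close>

datatype 'x star_word = Word "('x \<times> bool) list"

instantiation star_word :: (type) star_monoid
begin

definition zero_star_word :: "'a star_word" where
  "0 = Word []"

fun plus_star_word :: "'a star_word \<Rightarrow> 'a star_word \<Rightarrow> 'a star_word" where
  "Word v + Word w = Word (v @ w)"

fun mstar_star_word :: "'a star_word \<Rightarrow> 'a star_word" where
  "mstar (Word w) = Word (rev (map (\<lambda>(x, b). (x, \<not> b)) w))"

instance
proof
  fix u v w :: "'a star_word"
  show "u + v + w = u + (v + w)" by (cases u; cases v; cases w) simp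
  show "0 + u = u" "u + 0 = u" by (cases u; simp add: zero_star_word_def)+
  show "mstar (u + v) = mstar v + mstar u" by (cases u; cases v) simp
  show "mstar (mstar u) = u" by (cases u) (simp add: rev_map comp_def case_prod_beta)
qed

end

definition gen :: "'x \<Rightarrow> 'x star_word star_alg" where
  "gen x = basis (Word [(x, False)])"

lemma star_gen: "star (gen x) = basis (Word [(x, True)])"
  by (simp add: gen_def)

lemma bounded_relations_gen:
  assumes "\<And>\<nu> x. \<nu> \<in> admissible R \<Longrightarrow> \<nu> (gen x) \<le> 1"
  shows "bounded_relations R"
proof (rule bounded_relationsI)
  fix m :: "'a star_word"
  have "\<nu> (basis (Word w)) \<le> 1" if "\<nu> \<in> admissible R" for \<nu> w
  proof (induction w)
    have sn: "cstar_seminorm \<nu>" using that by (simp add: admissible_def)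
    case Nil
    have "basis (Word []) = (1 :: 'a star_word star_alg)"
      by (metis single_one zero_star_word_def)
    then show ?case using sn_one_le[OF sn] by simp
  next
    have sn: "cstar_seminorm \<nu>" using that by (simp add: admissible_def)
    case (Cons l w)
    obtain x b where l: "l = (x, b)" by (cases l)
    have "\<nu> (basis (Word [l])) \<le> 1"
      using assms[OF that, of x] sn_star[OF sn, of "gen x"] by (cases b) (simp_all add: star_gen l gen_def)
    moreover have "basis (Word (l # w)) = basis (Word [l]) * basis (Word w)"
      by (simp add: mult_single)
    ultimately show ?case
      using sn_mult[OF sn, of "basis (Word [l])" "basis (Word w)"] Cons
        mult_le_one[of "\<nu> (basis (Word [l]))" "\<nu> (basis (Word w))"] sn_nonneg[OF sn]
      by (metis order_trans)
  qed
  then show "\<exists>b. \<forall>\<nu>\<in>admissible R. \<nu> (basis m) \<le> b" by (metis star_word.exhaust)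
qed

text \<open>The free group is the quotient of the words by the least congruence that turns formal
  adjoints into inverses.\<close>

inductive free_group_eq :: "'x star_word \<Rightarrow> 'x star_word \<Rightarrow> bool" where
  cancel: "free_group_eq (w + mstar w) 0"
| refl: "free_group_eq w w"
| sym: "free_group_eq v w \<Longrightarrow> free_group_eq w v"
| trans: "free_group_eq u v \<Longrightarrow> free_group_eq v w \<Longrightarrow> free_group_eq u w"
| add: "free_group_eq u v \<Longrightarrow> free_group_eq u' v' \<Longrightarrow> free_group_eq (u + u') (v + v')"

quotient_type 'x free_group = "'x star_word" / free_group_eq
  by (rule equivpI)
     (auto simp: reflp_def symp_def transp_def intro: free_group_eq.refl free_group_eq.sym free_group_eq.trans)

lemma free_group_eq_mstar: "free_group_eq v w \<Longrightarrow> free_group_eq (mstar v) (mstar w)"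
proof (induction rule: free_group_eq.induct)
  case (cancel w)
  then show ?case by (simp add: mstar_add free_group_eq.cancel)
next
  case (trans u v w)
  then show ?case by (blast intro: free_group_eq.trans)
qed (auto simp: mstar_add intro: free_group_eq.intros(2,3,5))

text \<open>Groups, with inversion as involution.\<close>

class star_group = group_add + star_monoid +
  assumes mstar_eq_uminus: "mstar g = - g"

instantiation free_group :: (type) star_group
begin

lift_definition zero_free_group :: "'a free_group" is "0" .

lift_definition plus_free_group :: "'a free_group \<Rightarrow> 'a free_group \<Rightarrow> 'a free_group" is "(+)"
  by (rule free_group_eq.add)

lift_definition uminus_free_group :: "'a free_group \<Rightarrow> 'a free_group" is mstar
  by (rule free_group_eq_mstar)

definition minus_free_group :: "'a free_group \<Rightarrow> 'a free_group \<Rightarrow> 'a free_group" where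
  "g - h = g + (- h)" for g h :: "'a free_group"

definition mstar_free_group :: "'a free_group \<Rightarrow> 'a free_group" where
  "mstar g = - g" for g :: "'a free_group"

instance
proof
  fix a b c :: "'a free_group"
  show "a + b + c = a + (b + c)" by transfer (simp add: add.assoc free_group_eq.refl)
  show "0 + a = a" "a + 0 = a" by (transfer, simp add: free_group_eq.refl)+
  show "- a + a = 0" by transfer (metis free_group_eq.cancel mstar_mstar)
  show "a + - b = a - b" by (simp add: minus_free_group_def)
  show "mstar (a + b) = mstar b + mstar a"
    unfolding mstar_free_group_def by transfer (simp add: mstar_add free_group_eq.refl)
  show "mstar (mstar a) = a"
    unfolding mstar_free_group_def by transfer (simp add: free_group_eq.refl)
  show "mstar a = - a" by (rule mstar_free_group_def)
qed

end

lift_definition free_gen :: "'x \<Rightarrow> 'x free_group" is "\<lambda>x. Word [(x, False)]" .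

text \<open>The full group C*-algebra completes the group algebra for its largest C*-seminorm.
  The type of the group is carried by the type of the algebra.\<close>

definition full_group_cstar :: "(nat \<Rightarrow> 'g::star_group star_alg) set cstar" where
  "full_group_cstar = universal_cstar {}"

definition group_unitary :: "'g::star_group \<Rightarrow> (nat \<Rightarrow> 'g star_alg) set" where
  "group_unitary g = universal_map {} (basis g)"

lemma bounded_relations_group: "bounded_relations ({} :: ('g::star_group star_alg \<times> 'g star_alg) set)"
proof (rule bounded_relationsI)
  fix g :: 'g
  have "\<nu> (basis g) \<le> 1" if "\<nu> \<in> admissible {}" for \<nu>
  proof -
    have sn: "cstar_seminorm \<nu>" using that by (simp add: admissible_def)
    have "star (basis g) * basis g = 1" by (simp add: mult_single mstar_eq_uminus)
    then have "(\<nu> (basis g))\<^sup>2 \<le> 1" using sn_star_mult[OF sn, of "basis g"] sn_one_le[OF sn] by simp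
    then show ?thesis using sn_nonneg[OF sn] by (simp add: power_le_one_iff)
  qed
  then show "\<exists>b. \<forall>\<nu>\<in>admissible {}. \<nu> (basis g) \<le> b" by blast
qed


section \<open>The quantum groups\<close>

text \<open>Matrices are indexed by a finite type instead of \<open>{1..N}\<close>.\<close>

definition partial_isometry_rel :: "'m::star_monoid star_alg \<Rightarrow> ('m star_alg \<times> 'm star_alg) set" where
  "partial_isometry_rel x = {(x * star x * x, x)}"

definition magic_unitary_rel ::
    "('k::finite \<Rightarrow> 'k \<Rightarrow> 'm::star_monoid star_alg) \<Rightarrow> ('m star_alg \<times> 'm star_alg) set" where
  "magic_unitary_rel p =
     (\<Union>i j. {(star (p i j), p i j), (p i j * p i j, p i j)}) \<union>
     (\<Union>i. {(\<Sum>j\<in>UNIV. p i j, 1), (\<Sum>j\<in>UNIV. p j i, 1)})"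

primrec matrix_power :: "real^'n^'n \<Rightarrow> nat \<Rightarrow> real^'n^'n" where
  "matrix_power A 0 = mat 1"
| "matrix_power A (Suc k) = A ** matrix_power A k"

definition zero_one_matrix :: "real^'n^'n \<Rightarrow> bool" where
  "zero_one_matrix A \<longleftrightarrow> (\<forall>i j. A $ i $ j \<in> {0, 1})"

definition primitive_matrix :: "real^'n^'n \<Rightarrow> bool" where
  "primitive_matrix A \<longleftrightarrow> (\<exists>k\<ge>1. \<forall>i j. 0 < matrix_power A k $ i $ j)"

text \<open>For primitive matrices the normalised positive eigenvector exists and is unique by the
  Perron--Frobenius theorem; its eigenvalue is then necessarily the spectral radius.\<close>

definition is_perron_vector :: "real^'n^'n \<Rightarrow> real^'n \<Rightarrow> bool" where
  "is_perron_vector A w \<longleftrightarrow>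
     (\<exists>r. A *v w = r *s w) \<and> (\<forall>i. 0 < w $ i) \<and> (\<Sum>i\<in>UNIV. w $ i) = 1"

definition perron_vector :: "real^'n^'n \<Rightarrow> real^'n" where
  "perron_vector A = (THE w. is_perron_vector A w)"

definition admissible_words :: "real^'n^'n \<Rightarrow> nat \<Rightarrow> 'n list set" where
  "admissible_words A n = {\<alpha>. length \<alpha> = n \<and> (\<forall>i. Suc i < n \<longrightarrow> A $ (\<alpha> ! i) $ (\<alpha> ! Suc i) = 1)}"

abbreviation u_gen :: "'n \<Rightarrow> 'n \<Rightarrow> ('n \<times> 'n) star_word star_alg" where
  "u_gen i j \<equiv> gen (i, j)"

definition p_gen :: "'n \<Rightarrow> 'n \<Rightarrow> ('n \<times> 'n) star_word star_alg" where
  "p_gen i j = u_gen i j * star (u_gen i j)"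

definition q_gen :: "'n \<Rightarrow> 'n \<Rightarrow> ('n \<times> 'n) star_word star_alg" where
  "q_gen i j = star (u_gen i j) * u_gen i j"

definition fixes_vector_rel ::
    "('n::finite \<Rightarrow> 'n \<Rightarrow> 'm::star_monoid star_alg) \<Rightarrow> real^'n \<Rightarrow> ('m star_alg \<times> 'm star_alg) set" where
  "fixes_vector_rel p w =
     (\<Union>i. {(\<Sum>j\<in>UNIV. scale (complex_of_real (w $ j)) (p i j), scale (complex_of_real (w $ i)) 1)})"

text \<open>The last three groups of relations are \<open>p w = w 1 = q w\<close> for the Perron--Frobenius vector
  \<open>w\<close>, the identity \<open>A p = q A\<close>, and that \<open>u\<close>-products along two admissible words of equal
  length are partial isometries.\<close>

definition G_inf_rel ::
    "real^'n::finite^'n \<Rightarrow> (('n \<times> 'n) star_word star_alg \<times> ('n \<times> 'n) star_word star_alg) set" where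
  "G_inf_rel A =
     (\<Union>i j. partial_isometry_rel (u_gen i j)) \<union>
     magic_unitary_rel p_gen \<union> magic_unitary_rel q_gen \<union>
     fixes_vector_rel p_gen (perron_vector A) \<union> fixes_vector_rel q_gen (perron_vector A) \<union>
     (\<Union>i j. {(\<Sum>k\<in>UNIV. scale (complex_of_real (A $ i $ k)) (p_gen k j),
              \<Sum>k\<in>UNIV. scale (complex_of_real (A $ k $ j)) (q_gen i k))}) \<union>
     (\<Union>n. \<Union>\<alpha>\<in>admissible_words A n. \<Union>\<beta>\<in>admissible_words A n.
        partial_isometry_rel (prod_list (map2 u_gen \<alpha> \<beta>)))"

definition C_G_inf :: "real^'n::finite^'n \<Rightarrow> (nat \<Rightarrow> ('n \<times> 'n) star_word star_alg) set cstar" where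
  "C_G_inf A = universal_cstar (G_inf_rel A)"

definition u_elem :: "real^'n::finite^'n \<Rightarrow> 'n \<Rightarrow> 'n \<Rightarrow> (nat \<Rightarrow> ('n \<times> 'n) star_word star_alg) set" where
  "u_elem A i j = universal_map (G_inf_rel A) (u_gen i j)"

definition QAut_rel ::
    "complex^'k::finite^'k \<Rightarrow> (('k \<times> 'k) star_word star_alg \<times> ('k \<times> 'k) star_word star_alg) set" where
  "QAut_rel T =
     magic_unitary_rel u_gen \<union>
     (\<Union>i j. {(\<Sum>k\<in>UNIV. scale (T $ i $ k) (u_gen k j), \<Sum>k\<in>UNIV. scale (T $ k $ j) (u_gen i k))})"

definition C_QAut :: "complex^'k::finite^'k \<Rightarrow> (nat \<Rightarrow> ('k \<times> 'k) star_word star_alg) set cstar" where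
  "C_QAut T = universal_cstar (QAut_rel T)"

definition QAut_trivial :: "complex^'k::finite^'k \<Rightarrow> bool" where
  "QAut_trivial T \<longleftrightarrow> carrier (C_QAut T) = {cscale (C_QAut T) c \<one>\<^bsub>C_QAut T\<^esub> | c. True}"

lemma sn_eq_mod: "cstar_seminorm \<nu> \<Longrightarrow> \<nu> (a - b) = 0 \<Longrightarrow> \<nu> a = \<nu> b"
  using sn_abs[of \<nu> a b] by simp

lemma sn_mod_mult:
  assumes sn: "cstar_seminorm \<nu>" and "\<nu> (a - b) = 0"
  shows "\<nu> (c * a) = \<nu> (c * b)" "\<nu> (a * c) = \<nu> (b * c)"
proof -
  have "\<nu> (c * (a - b)) = 0" "\<nu> ((a - b) * c) = 0"
    using sn_mult[OF sn, of c "a - b"] sn_mult[OF sn, of "a - b" c] assms(2)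
      sn_nonneg[OF sn, of "c * (a - b)"] sn_nonneg[OF sn, of "(a - b) * c"] by auto
  then show "\<nu> (c * a) = \<nu> (c * b)" "\<nu> (a * c) = \<nu> (b * c)"
    by (auto intro!: sn_eq_mod[OF sn] simp: algebra_simps)
qed

lemma sq_le_1: "0 \<le> r \<Longrightarrow> r\<^sup>2 = r \<Longrightarrow> r \<le> (1::real)"
  by (metis dual_order.refl mult_cancel_right1 power2_eq_square zero_le_one)

lemma bounded_relations_G_inf: "bounded_relations (G_inf_rel A)"
proof (rule bounded_relations_gen)
  fix \<nu> and x :: "'a \<times> 'a"
  assume \<nu>: "\<nu> \<in> admissible (G_inf_rel A)"
  then have sn: "cstar_seminorm \<nu>" by (simp add: admissible_def)
  obtain i j where x: "x = (i, j)" by (cases x)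
  let ?u = "gen x"
  have "(?u * star ?u * ?u, ?u) \<in> G_inf_rel A"
    by (auto simp: G_inf_rel_def partial_isometry_rel_def x)
  then have "\<nu> (?u * star ?u * ?u - ?u) = 0" using \<nu> by (auto simp: admissible_def)
  from sn_mod_mult(1)[OF sn this, of "star ?u"]
  have "\<nu> (star (star ?u * ?u) * (star ?u * ?u)) = \<nu> (star ?u * ?u)"
    by (simp add: star_mult mult.assoc)
  then have "((\<nu> ?u)\<^sup>2)\<^sup>2 = (\<nu> ?u)\<^sup>2" using sn_star_mult[OF sn] by metis
  then have "(\<nu> ?u)\<^sup>2 \<le> 1" by (intro sq_le_1) auto
  then show "\<nu> ?u \<le> 1" using sn_nonneg[OF sn] by (simp add: power_le_one_iff)
qed

lemma bounded_relations_QAut: "bounded_relations (QAut_rel T)"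
proof (rule bounded_relations_gen)
  fix \<nu> and x :: "'a \<times> 'a"
  assume \<nu>: "\<nu> \<in> admissible (QAut_rel T)"
  then have sn: "cstar_seminorm \<nu>" by (simp add: admissible_def)
  obtain i j where x: "x = (i, j)" by (cases x)
  let ?u = "gen x"
  have "(star ?u, ?u) \<in> QAut_rel T" "(?u * ?u, ?u) \<in> QAut_rel T"
    by (auto simp: QAut_rel_def magic_unitary_rel_def x)
  then have *: "\<nu> (star ?u - ?u) = 0" "\<nu> (?u * ?u - ?u) = 0" using \<nu> by (auto simp: admissible_def)
  have "(\<nu> ?u)\<^sup>2 = \<nu> ?u"
    using sn_mod_mult(2)[OF sn *(1), of ?u] sn_eq_mod[OF sn *(2)] sn_star_mult[OF sn, of ?u] by simp
  then show "\<nu> ?u \<le> 1" using sn_nonneg[OF sn] by (intro sq_le_1)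
qed

text \<open>The basis of the tensor square is indexed by pairs.\<close>

definition kronecker :: "real^'n::finite^'n \<Rightarrow> real^'n^'n \<Rightarrow> real^('n \<times> 'n)^('n \<times> 'n)" where
  "kronecker M N = (\<chi> r s. M $ fst r $ fst s * N $ snd r $ snd s)"

definition flip_matrix :: "real^('n::finite \<times> 'n)^('n \<times> 'n)" where
  "flip_matrix = (\<chi> r s. if r = prod.swap s then 1 else 0)"

definition T_matrix :: "real^'n::finite^'n \<Rightarrow> complex^('n \<times> 'n)^('n \<times> 'n)" where
  "T_matrix A = (\<chi> r s. complex_of_real ((kronecker (transpose A) A ** flip_matrix) $ r $ s))"

end

theory Submission
  imports Defs
begin

text \<open>Take \<open>A = ((1, 1), (1, 0))\<close>. The entries of its Perron--Frobenius vector are distinct, so a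
  \<open>2 \<times> 2\<close> magic unitary fixing this vector is the identity matrix: the off-diagonal \<open>u\<^sub>i\<^sub>j\<close> vanish
  and the diagonal ones are unitary. Hence every C*-seminorm respecting the relations factors
  through the group algebra of the free group, the canonical map is isometric for the two largest
  seminorms, and no spectral theory is needed to pass to the completions. On the
  other hand \<open>A\<close> is symmetric, so the flip of \<open>{1,2} \<times> {1,2}\<close> commutes with \<open>T\<^sub>A\<close>, and
  the characters of \<open>C(QAut(T\<^sub>A))\<close> given by the identity and by the flip differ.\<close>

section \<open>Extending maps to the *-algebra of words\<close>

text \<open>One set of axioms for two targets: the complex numbers, which give characters, and a
  monoid *-algebra, which gives the canonical map. The map \<open>emb\<close> is the central copy of
  the scalars.\<close>

locale star_target =
  fixes emb :: "complex \<Rightarrow> 'b::ring_1" and adj :: "'b \<Rightarrow> 'b"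
  assumes emb_add: "emb (c + d) = emb c + emb d"
    and emb_mult: "emb (c * d) = emb c * emb d"
    and emb_1: "emb 1 = 1"
    and emb_commute: "emb c * x = x * emb c"
    and adj_add: "adj (x + y) = adj x + adj y"
    and adj_mult: "adj (x * y) = adj y * adj x"
    and adj_emb: "adj (emb c) = emb (cnj c)"
    and adj_adj: "adj (adj x) = x"
begin

lemma emb_0: "emb 0 = 0"
  using emb_add[of 0 0] by simp

lemma adj_0: "adj 0 = 0"
  using adj_emb[of 0] by (simp add: emb_0)

lemma adj_1: "adj 1 = 1"
  using adj_emb[of 1] by (simp add: emb_1)

text \<open>Linear extension from the basis. Nothing is assumed about \<open>f\<close> here, so that
  it also serves for a section that is multiplicative only modulo a seminorm.\<close>

definition extend :: "('m::star_monoid \<Rightarrow> 'b) \<Rightarrow> 'm star_alg \<Rightarrow> 'b" where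
  "extend f x = (\<Sum>m\<in>Poly_Mapping.keys x. emb (Poly_Mapping.lookup x m) * f m)"

lemma extend_superset:
  assumes "finite K" "Poly_Mapping.keys x \<subseteq> K"
  shows "extend f x = (\<Sum>m\<in>K. emb (Poly_Mapping.lookup x m) * f m)"
  unfolding extend_def using assms
  by (intro sum.mono_neutral_left) (auto simp: in_keys_iff emb_0)

lemma extend_0: "extend f 0 = 0"
  by (simp add: extend_def)

lemma extend_single: "extend f (Poly_Mapping.single m c) = emb c * f m"
  by (simp add: extend_superset[of "{m}"])

lemma extend_add: "extend f (x + y) = extend f x + extend f y"
proof -
  let ?K = "Poly_Mapping.keys x \<union> Poly_Mapping.keys y"
  have "extend f z = (\<Sum>m\<in>?K. emb (Poly_Mapping.lookup z m) * f m)" if "z \<in> {x, y, x + y}" for z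
    using that keys_add[of x y] by (intro extend_superset) auto
  then show ?thesis by (simp add: lookup_add emb_add distrib_right sum.distrib)
qed

lemma extend_uminus: "extend f (- x) = - extend f x"
  using extend_add[of f x "- x"] by (simp add: extend_0 eq_neg_iff_add_eq_0 add.commute)

lemma extend_diff: "extend f (x - y) = extend f x - extend f y"
  using extend_add[of f x "- y"] by (simp add: extend_uminus)

lemma extend_1: "f 0 = 1 \<Longrightarrow> extend f 1 = 1"
  using extend_single[of f 0 1] by (simp add: emb_1)

lemma extend_mult:
  assumes f: "\<And>m n. f (m + n) = f m * f n"
  shows "extend f (x * y) = extend f x * extend f y"
proof (induction x rule: star_alg_induct)
  case (single m c)
  show ?case
  proof (induction y rule: star_alg_induct)
    case (single n d)
    have "emb c * (emb d * (f m * f n)) = emb c * (f m * (emb d * f n))"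
      by (metis emb_commute mult.assoc)
    then show ?case by (simp add: mult_single extend_single f emb_mult mult.assoc)
  qed (simp_all add: distrib_left extend_add extend_0)
qed (simp_all add: distrib_right extend_add extend_0)

lemma extend_scale: "extend f (scale c x) = emb c * extend f x"
  by (induction x rule: star_alg_induct)
     (simp_all add: scale_add extend_add extend_0 distrib_left extend_single emb_mult mult.assoc
        scale_def mult_single)

lemma extend_star:
  assumes f: "\<And>m. f (mstar m) = adj (f m)"
  shows "extend f (star x) = adj (extend f x)"
  by (induction x rule: star_alg_induct)
     (simp_all add: star_add extend_add extend_0 extend_single adj_0 adj_add adj_mult adj_emb f emb_commute)

section \<open>Homomorphisms out of the free unital *-algebra\<close>

definition word_prod :: "('x \<Rightarrow> 'b) \<Rightarrow> 'x star_word \<Rightarrow> 'b" where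
  "word_prod v w = (case w of Word l \<Rightarrow> prod_list (map (\<lambda>(x, b). if b then adj (v x) else v x) l))"

lemma word_prod_0: "word_prod v 0 = 1"
  by (simp add: word_prod_def zero_star_word_def)

lemma word_prod_add: "word_prod v (w + w') = word_prod v w * word_prod v w'"
  by (cases w; cases w') (simp add: word_prod_def)

lemma word_prod_mstar: "word_prod v (mstar w) = adj (word_prod v w)"
proof (cases w)
  case (Word l)
  show ?thesis unfolding Word
    by (induction l) (auto simp: word_prod_def adj_1 adj_mult adj_adj)
qed

text \<open>The universal property of the free unital *-algebra: the generators may be sent
  anywhere.\<close>

definition word_hom :: "('x \<Rightarrow> 'b) \<Rightarrow> 'x star_word star_alg \<Rightarrow> 'b" where
  "word_hom v = extend (word_prod v)"

lemma word_hom_gen: "word_hom v (gen x) = v x"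
  by (simp add: word_hom_def gen_def extend_single word_prod_def emb_1)

lemma word_hom_0: "word_hom v 0 = 0"
  and word_hom_add: "word_hom v (x + y) = word_hom v x + word_hom v y"
  and word_hom_diff: "word_hom v (x - y) = word_hom v x - word_hom v y"
  and word_hom_1: "word_hom v 1 = 1"
  and word_hom_mult: "word_hom v (x * y) = word_hom v x * word_hom v y"
  and word_hom_scale: "word_hom v (scale c x) = emb c * word_hom v x"
  and word_hom_star: "word_hom v (star x) = adj (word_hom v x)"
  by (simp_all add: word_hom_def extend_0 extend_add extend_diff extend_1 extend_mult extend_scale extend_star
      word_prod_0 word_prod_add word_prod_mstar)

lemma word_hom_sum: "word_hom v (\<Sum>i\<in>I. f i) = (\<Sum>i\<in>I. word_hom v (f i))"
  by (induction I rule: infinite_finite_induct) (simp_all add: word_hom_0 word_hom_add)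

lemmas word_hom_simps = word_hom_gen word_hom_0 word_hom_add word_hom_diff word_hom_1
  word_hom_mult word_hom_scale word_hom_star word_hom_sum

end

lemma scale_commute: "Poly_Mapping.single 0 c * x = x * Poly_Mapping.single 0 c"
  for x :: "'m::star_monoid star_alg"
  using scale_mult_right[of c x 1] by (simp add: scale_def)

global_interpretation complex_target: star_target "\<lambda>c. c" cnj
  by unfold_locales auto

global_interpretation alg_target: star_target "Poly_Mapping.single 0" "star :: 'm::star_monoid star_alg \<Rightarrow> _"
  by unfold_locales
     (auto simp: single_add mult_single scale_commute star_add star_mult)

section \<open>Isomorphisms of completions\<close>

definition star_alg_hom :: "('m::star_monoid star_alg \<Rightarrow> 'n::star_monoid star_alg) \<Rightarrow> bool" where
  "star_alg_hom \<rho> \<longleftrightarrow>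
     (\<forall>x y. \<rho> (x + y) = \<rho> x + \<rho> y) \<and> (\<forall>x y. \<rho> (x * y) = \<rho> x * \<rho> y) \<and> \<rho> 1 = 1 \<and>
     (\<forall>c x. \<rho> (scale c x) = scale c (\<rho> x)) \<and> (\<forall>x. \<rho> (star x) = star (\<rho> x))"

lemma star_alg_hom_word_hom: "star_alg_hom (alg_target.word_hom v)"
  by (simp add: star_alg_hom_def alg_target.word_hom_simps flip: scale_def)

lemma star_alg_hom_diff: "star_alg_hom \<rho> \<Longrightarrow> \<rho> (x - y) = \<rho> x - \<rho> y"
  unfolding star_alg_hom_def by (metis add_diff_cancel_right' diff_add_cancel)

text \<open>An isometric \<open>\<rho>\<close> preserves and reflects Cauchy and null sequences, so
  acting termwise on representatives is well defined and injective on classes. Surjectivity passes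
  to the completions because \<open>\<rho>\<close> itself is onto, not merely of dense
  range.\<close>

lemma completion_iso:
  assumes \<nu>: "cstar_seminorm \<nu>" and \<mu>: "cstar_seminorm \<mu>"
    and hom: "star_alg_hom \<rho>" and surj: "surj \<rho>" and isometric: "\<And>x. \<mu> (\<rho> x) = \<nu> x"
  shows "\<exists>\<phi>\<in>cstar_iso (cstar_completion \<nu>) (cstar_completion \<mu>).
    \<forall>x. \<phi> (cauchy_class \<nu> (\<lambda>n. x)) = cauchy_class \<mu> (\<lambda>n. \<rho> x)"
proof -
  note h = hom[unfolded star_alg_hom_def] and d = star_alg_hom_diff[OF hom]
  have cauchy: "cauchy_seq \<mu> (\<lambda>n. \<rho> (s n)) \<longleftrightarrow> cauchy_seq \<nu> s" for s
    by (simp add: cauchy_seq_def isometric flip: d)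
  have null: "null_seq \<mu> (\<lambda>n. \<rho> (s n) - \<rho> (t n)) \<longleftrightarrow> null_seq \<nu> (\<lambda>n. s n - t n)" for s t
    by (simp add: null_seq_def isometric flip: d)
  define \<phi> where "\<phi> X = cauchy_class \<mu> (\<lambda>n. \<rho> (some_rep X n))" for X
  have \<phi>: "\<phi> (cauchy_class \<nu> s) = cauchy_class \<mu> (\<lambda>n. \<rho> (s n))" if "cauchy_seq \<nu> s" for s
    unfolding \<phi>_def using some_rep[OF \<nu> that] that by (simp add: class_eq[OF \<mu>] cauchy null)
  note C = completion_carrier[OF \<nu>] and D = completion_carrier[OF \<mu>]
    and S = completion_simps[OF \<nu>] completion_simps[OF \<mu>]
  have "\<phi> \<in> ring_hom (cstar_completion \<nu>) (cstar_completion \<mu>)"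
    by (rule ring_hom_memI) (auto simp: C \<phi> S cauchy h intro!: class_carrier[OF \<mu>])
  moreover have "bij_betw \<phi> (carrier (cstar_completion \<nu>)) (carrier (cstar_completion \<mu>))"
  proof (rule bij_betw_imageI)
    show "inj_on \<phi> (carrier (cstar_completion \<nu>))"
    proof (rule inj_onI)
      fix X Y assume "X \<in> carrier (cstar_completion \<nu>)" "Y \<in> carrier (cstar_completion \<nu>)" "\<phi> X = \<phi> Y"
      then show "X = Y" unfolding C by (elim exE conjE) (simp add: \<phi> class_eq[OF \<mu>] class_eq[OF \<nu>] cauchy null)
    qed
    show "\<phi> ` carrier (cstar_completion \<nu>) = carrier (cstar_completion \<mu>)"
    proof (intro equalityI subsetI)
      fix Y assume "Y \<in> carrier (cstar_completion \<mu>)"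
      then obtain t where t: "cauchy_seq \<mu> t" "Y = cauchy_class \<mu> t" by (auto simp: D)
      \<comment> \<open>Preimages are chosen term by term; isometry makes the chosen sequence Cauchy
        again.\<close>
      define s where "s n = inv_into UNIV \<rho> (t n)" for n
      have "\<rho> (s n) = t n" for n by (simp add: s_def surj_f_inv_f[OF surj])
      then have "cauchy_seq \<nu> s" "Y = \<phi> (cauchy_class \<nu> s)"
        using t cauchy[of s] \<phi>[of s] by simp_all
      then show "Y \<in> \<phi> ` carrier (cstar_completion \<nu>)" by (auto intro!: imageI class_carrier[OF \<nu>])
    qed (auto simp: C \<phi> cauchy intro!: class_carrier[OF \<mu>])
  qed
  ultimately have "\<phi> \<in> cstar_iso (cstar_completion \<nu>) (cstar_completion \<mu>)"
    unfolding cstar_iso_def cstar_hom_def by (auto simp: C \<phi> S cauchy h)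
  then show ?thesis using \<phi>[OF cauchy_const[OF \<nu>]] by blast
qed

section \<open>Transport of seminorms along a surjection\<close>

lemma seminorm_pullback:
  assumes \<mu>: "cstar_seminorm \<mu>" and hom: "star_alg_hom \<rho>"
  shows "cstar_seminorm (\<lambda>x. \<mu> (\<rho> x))"
  using assms by (simp add: cstar_seminorm_def star_alg_hom_def flip: power2_eq_square)

text \<open>Two preimages of one element differ by an element of the kernel of
  \<open>\<rho>\<close>, on which \<open>\<nu>\<close> vanishes; hence \<open>\<nu>\<close> takes
  the same value on both.\<close>

lemma seminorm_factor:
  assumes \<nu>: "cstar_seminorm \<nu>" and hom: "star_alg_hom \<rho>" and surj: "surj \<rho>"
    and ker: "\<And>x. \<rho> x = 0 \<Longrightarrow> \<nu> x = 0"
  obtains \<mu> where "cstar_seminorm \<mu>" "\<And>x. \<mu> (\<rho> x) = \<nu> x"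
proof
  let ?\<mu> = "\<lambda>y. \<nu> (inv_into UNIV \<rho> y)"
  show eq: "?\<mu> (\<rho> x) = \<nu> x" for x
    by (rule sn_eq_mod[OF \<nu>]) (simp add: ker star_alg_hom_diff[OF hom] surj_f_inv_f[OF surj])
  note h = hom[unfolded star_alg_hom_def]
  have "?\<mu> (\<rho> a + \<rho> b) \<le> ?\<mu> (\<rho> a) + ?\<mu> (\<rho> b)" "?\<mu> (\<rho> a * \<rho> b) \<le> ?\<mu> (\<rho> a) * ?\<mu> (\<rho> b)"
    "?\<mu> (scale c (\<rho> a)) = cmod c * ?\<mu> (\<rho> a)" "?\<mu> (star (\<rho> a) * \<rho> a) = (?\<mu> (\<rho> a))\<^sup>2" for a b c
    using eq sn_add[OF \<nu>, of a b] sn_mult[OF \<nu>, of a b] sn_scale[OF \<nu>, of c a] sn_star_mult[OF \<nu>, of a] h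
    by metis+
  then show "cstar_seminorm ?\<mu>"
    unfolding cstar_seminorm_def using surj by (metis surjD)
qed

text \<open>Pulling back and factoring match the C*-seminorms on the target with those admissible
  for \<open>R\<close>. The two suprema therefore agree along \<open>\<rho>\<close>, which is the
  isometry that the completions require.\<close>

lemma universal_iso:
  assumes R: "bounded_relations R" and S: "bounded_relations ({} :: ('n::star_monoid star_alg \<times> _) set)"
    and hom: "star_alg_hom \<rho>" and surj: "surj (\<rho> :: _ \<Rightarrow> 'n star_alg)"
    and rel: "\<And>a b. (a, b) \<in> R \<Longrightarrow> \<rho> a = \<rho> b"
    and ker: "\<And>\<nu> x. \<nu> \<in> admissible R \<Longrightarrow> \<rho> x = 0 \<Longrightarrow> \<nu> x = 0"
  shows "\<exists>\<phi>\<in>cstar_iso (universal_cstar R) (universal_cstar {}).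
    \<forall>x. \<phi> (universal_map R x) = universal_map {} (\<rho> x)"
  unfolding universal_cstar_def universal_map_def
proof (rule completion_iso[OF max_seminorm_cstar[OF R] max_seminorm_cstar[OF S] hom surj])
  fix x
  show "max_seminorm {} (\<rho> x) = max_seminorm R x"
  proof (rule antisym)
    show "max_seminorm {} (\<rho> x) \<le> max_seminorm R x"
    proof (rule max_seminorm_least)
      fix \<mu> :: "'n star_alg \<Rightarrow> real" assume "\<mu> \<in> admissible {}"
      then have "cstar_seminorm \<mu>" by (simp add: admissible_def)
      then have "(\<lambda>x. \<mu> (\<rho> x)) \<in> admissible R"
        using seminorm_pullback[OF _ hom, of \<mu>]
        by (auto simp: admissible_def star_alg_hom_diff[OF hom] rel sn_0)
      then show "\<mu> (\<rho> x) \<le> max_seminorm R x" by (rule max_seminorm_upper[OF R])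
    qed
    show "max_seminorm R x \<le> max_seminorm {} (\<rho> x)"
    proof (rule max_seminorm_least)
      fix \<nu> assume \<nu>: "\<nu> \<in> admissible R"
      then have "cstar_seminorm \<nu>" by (simp add: admissible_def)
      then obtain \<mu> where "cstar_seminorm \<mu>" "\<And>x. \<mu> (\<rho> x) = \<nu> x"
        using seminorm_factor[of \<nu> \<rho>, OF _ hom surj] ker[OF \<nu>] by blast
      then show "\<nu> x \<le> max_seminorm {} (\<rho> x)"
        using max_seminorm_upper[OF S, of \<mu> "\<rho> x"] by (simp add: admissible_def)
    qed
  qed
qed

section \<open>The diagonal words\<close>

lemma sn_mod_add:
  assumes \<nu>: "cstar_seminorm \<nu>" and "\<nu> (a - b) = 0" "\<nu> (c - d) = 0"
  shows "\<nu> (a + c - (b + d)) = 0"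
  using sn_add[OF \<nu>, of "a - b" "c - d"] sn_nonneg[OF \<nu>, of "a + c - (b + d)"] assms(2,3)
  by (simp add: algebra_simps)

lemma sn_mod_trans:
  assumes \<nu>: "cstar_seminorm \<nu>" and "\<nu> (a - b) = 0" "\<nu> (b - c) = 0"
  shows "\<nu> (a - c) = 0"
  using sn_triangle[OF \<nu>, of a c b] sn_nonneg[OF \<nu>, of "a - c"] assms(2,3) by simp

lemma sn_mod_mult2:
  assumes \<nu>: "cstar_seminorm \<nu>" and "\<nu> (a - b) = 0" "\<nu> (c - d) = 0"
  shows "\<nu> (a * c - b * d) = 0"
  using sn_mult_diff[OF \<nu>, of a c b d] sn_nonneg[OF \<nu>, of "a * c - b * d"] assms(2,3) by simp

lemma sn_zero_mult:
  assumes \<nu>: "cstar_seminorm \<nu>" and "\<nu> a = 0 \<or> \<nu> b = 0"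
  shows "\<nu> (a * b) = 0"
  using sn_mult[OF \<nu>, of a b] sn_nonneg[OF \<nu>, of "a * b"] assms(2) by auto

lemma basis_add: "basis (m + n) = basis m * basis n"
  by (simp add: mult_single)

text \<open>Lifts a word in the free generators to the same word in the diagonal
  \<open>u_gen x x\<close>.\<close>

definition diag :: "'x star_word \<Rightarrow> ('x \<times> 'x) star_word" where
  "diag w = (case w of Word l \<Rightarrow> Word (map (\<lambda>(x, b). ((x, x), b)) l))"

lemma diag_0: "diag 0 = 0"
  by (simp add: diag_def zero_star_word_def)

lemma diag_add: "diag (v + w) = diag v + diag w"
  by (cases v; cases w) (simp add: diag_def)

lemma star_word_induct [case_names zero letter]:
  assumes "P 0" "\<And>x b w. P w \<Longrightarrow> P (Word [(x, b)] + w)"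
  shows "P w"
proof -
  have "P (Word l)" for l
  proof (induction l)
    case Nil
    then show ?case using assms(1) by (simp add: zero_star_word_def)
  next
    case (Cons y l)
    then show ?case using assms(2)[of "Word l" "fst y" "snd y"] by simp
  qed
  then show ?thesis by (cases w) simp
qed

text \<open>Congruence modulo \<open>\<nu>\<close> is compatible with products, and unitarity of the
  diagonal generators modulo \<open>\<nu>\<close> supplies the cancellation rule. So it contains the
  congruence defining the free group.\<close>

lemma diag_free_group_eq:
  assumes \<nu>: "cstar_seminorm \<nu>"
    and unitary: "\<And>x. \<nu> (gen (x, x) * star (gen (x, x)) - 1) = 0" "\<And>x. \<nu> (star (gen (x, x)) * gen (x, x) - 1) = 0"
  shows "free_group_eq v w \<Longrightarrow> \<nu> (basis (diag v) - basis (diag w)) = 0"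
proof (induction rule: free_group_eq.induct)
  case (cancel w)
  have "\<nu> (basis (diag w) * basis (diag (mstar w)) - 1) = 0"
  proof (induction w rule: star_word_induct)
    case zero
    then show ?case by (simp add: diag_0 sn_0[OF \<nu>])
  next
    case (letter x b w)
    define a where "a = basis (diag (Word [(x, b)]))"
    define a' where "a' = basis (diag (mstar (Word [(x, b)])))"
    have "\<nu> (a * a' - 1) = 0"
      using unitary[of x] by (cases b) (simp_all add: a_def a'_def diag_def gen_def)
    \<comment> \<open>The adjoint reverses words, so the induction hypothesis cancels the inner
      factor between the first letter and its adjoint, and these cancel next.\<close>
    moreover have "\<nu> (a * (basis (diag w) * basis (diag (mstar w))) * a' - a * 1 * a') = 0"
      using letter sn_0[OF \<nu>] by (intro sn_mod_mult2[OF \<nu>]) auto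
    ultimately have "\<nu> (a * (basis (diag w) * basis (diag (mstar w))) * a' - 1) = 0"
      using sn_mod_trans[OF \<nu>] by simp
    then show ?case by (simp add: mstar_add diag_add basis_add a_def a'_def mult.assoc del: mstar_star_word.simps plus_star_word.simps)
  qed
  then show ?case by (simp add: diag_add diag_0 basis_add)
next
  case (refl w)
  then show ?case by (simp add: sn_0[OF \<nu>])
next
  case (sym v w)
  then show ?case by (simp add: sn_commute[OF \<nu>])
next
  case (trans u v w)
  then show ?case using sn_mod_trans[OF \<nu>] by blast
next
  case (add u v u' v')
  then show ?case using sn_mod_mult2[OF \<nu>] by (simp add: diag_add basis_add)
qed

section \<open>The canonical surjection\<close>

definition canonical_hom :: "('x \<times> 'x) star_word star_alg \<Rightarrow> 'x free_group star_alg" where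
  "canonical_hom = alg_target.word_hom (\<lambda>(i, j). if i = j then basis (free_gen i) else 0)"

lemma star_alg_hom_canonical: "star_alg_hom canonical_hom"
  unfolding canonical_hom_def by (rule star_alg_hom_word_hom)

lemmas canonical_hom_simps = alg_target.word_hom_simps
  [where v = "\<lambda>(i, j). if i = j then basis (free_gen i) else 0", folded canonical_hom_def scale_def]

lemma canonical_hom_u_gen: "canonical_hom (u_gen i j) = (if i = j then basis (free_gen i) else 0)"
  by (simp add: canonical_hom_simps)

lemma canonical_hom_p_gen: "canonical_hom (p_gen i j) = (if i = j then 1 else 0)"
  and canonical_hom_q_gen: "canonical_hom (q_gen i j) = (if i = j then 1 else 0)"
  by (auto simp: p_gen_def q_gen_def canonical_hom_simps mult_single mstar_eq_uminus)

lemma canonical_hom_diag: "canonical_hom (basis (diag w)) = basis (abs_free_group w)"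
proof (induction w rule: star_word_induct)
  case zero
  then show ?case by (simp add: diag_0 canonical_hom_simps flip: zero_free_group_def)
next
  case (letter x b w)
  have "canonical_hom (basis (diag (Word [(x, b)]))) = basis (abs_free_group (Word [(x, b)]))"
  proof (cases b)
    case True
    have "basis (diag (Word [(x, b)])) = star (u_gen x x)"
      using True by (simp add: diag_def star_gen)
    moreover have "abs_free_group (Word [(x, b)]) = - free_gen x"
      using True by (simp add: free_gen_def uminus_free_group.abs_eq)
    ultimately show ?thesis by (simp add: canonical_hom_simps mstar_eq_uminus)
  next
    case False
    then have "basis (diag (Word [(x, b)])) = u_gen x x"
      by (simp add: diag_def gen_def)
    then show ?thesis using False by (simp add: canonical_hom_simps free_gen_def)
  qed
  then show ?case using letter
    by (simp add: diag_add basis_add canonical_hom_simps del: plus_star_word.simps flip: plus_free_group.abs_eq)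
qed

lemma surj_canonical_hom: "surj canonical_hom"
proof -
  have "\<exists>x. y = canonical_hom x" for y :: "'a free_group star_alg"
  proof (induction y rule: star_alg_induct)
    case zero
    then show ?case using canonical_hom_simps(2) by metis
  next
    case (single g c)
    \<comment> \<open>The diagonal lift of any representative word is a preimage of the group
      element.\<close>
    have "canonical_hom (scale c (basis (diag (rep_free_group g)))) = scale c (basis g)"
      using Quotient3_abs_rep[OF Quotient3_free_group, of g] by (simp add: canonical_hom_simps canonical_hom_diag)
    then show ?case by (metis single_eq_scale)
  next
    case (add x y)
    then show ?case using canonical_hom_simps(3) by metis
  qed
  then show ?thesis by (auto simp: surj_def)
qed

text \<open>Every element is congruent modulo \<open>\<nu>\<close> to the section applied to its
  image; an element with image zero is thus congruent to zero.\<close>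

lemma canonical_hom_kernel:
  fixes \<nu> :: "('x \<times> 'x) star_word star_alg \<Rightarrow> real"
  assumes \<nu>: "cstar_seminorm \<nu>"
    and off: "\<And>i j. i \<noteq> j \<Longrightarrow> \<nu> (u_gen i j) = 0"
    and unitary: "\<And>x. \<nu> (u_gen x x * star (u_gen x x) - 1) = 0" "\<And>x. \<nu> (star (u_gen x x) * u_gen x x - 1) = 0"
    and x: "canonical_hom x = 0"
  shows "\<nu> x = 0"
proof -
  \<comment> \<open>A linear section of the canonical map, multiplicative only modulo \<open>\<nu>\<close>.\<close>
  define \<sigma> where "\<sigma> = alg_target.extend (\<lambda>g::'x free_group. basis (diag (rep_free_group g)))"
  \<comment> \<open>A single off-diagonal letter kills a word both under \<open>\<nu>\<close> and
    under the canonical map, so only diagonal words need the free group.\<close>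
  have diag_or_zero: "(\<exists>v. w = diag v) \<or> (\<nu> (basis w) = 0 \<and> canonical_hom (basis w) = 0)" for w
  proof (induction w rule: star_word_induct)
    case zero
    then show ?case using diag_0 by metis
  next
    case (letter y b w)
    obtain i j where y: "y = (i, j)" by (cases y)
    show ?case
    proof (cases "i = j")
      case True
      then have "Word [(y, b)] = diag (Word [(i, b)])" by (simp add: y diag_def)
      then show ?thesis
        using letter by (metis diag_add basis_add canonical_hom_simps(6) mult_zero_right sn_zero_mult[OF \<nu>])
    next
      case False
      have b: "basis (Word [(y, b)]) = (if b then star (u_gen i j) else u_gen i j)"
        by (simp add: y star_gen) (simp add: gen_def)
      have "\<nu> (basis (Word [(y, b)])) = 0" "canonical_hom (basis (Word [(y, b)])) = 0"
        using False off[OF False] unfolding b by (simp_all add: sn_star[OF \<nu>] canonical_hom_simps)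
      then show ?thesis by (metis basis_add canonical_hom_simps(6) mult_zero_left sn_zero_mult[OF \<nu>])
    qed
  qed
  have basis: "\<nu> (basis w - \<sigma> (canonical_hom (basis w))) = 0" for w
    using diag_or_zero[of w]
  proof (elim disjE exE conjE)
    fix v assume w: "w = diag v"
    \<comment> \<open>The representative chosen by \<open>rep_free_group\<close> need not be
      \<open>v\<close>, only equivalent to it; \<open>diag_free_group_eq\<close> absorbs the
      difference.\<close>
    have "free_group_eq v (rep_free_group (abs_free_group v))"
      using Quotient3_rep_abs[OF Quotient3_free_group, of v] by (metis free_group_eq.refl free_group_eq.sym)
    then show ?thesis
      using diag_free_group_eq[OF \<nu> unitary]
      by (simp add: w canonical_hom_diag \<sigma>_def alg_target.extend_single)
  next
    assume "\<nu> (basis w) = 0" "canonical_hom (basis w) = 0"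
    then show ?thesis by (simp add: \<sigma>_def alg_target.extend_0)
  qed
  have "\<nu> (y - \<sigma> (canonical_hom y)) = 0" for y
  proof (induction y rule: star_alg_induct)
    case zero
    then show ?case by (simp add: \<sigma>_def alg_target.extend_0 canonical_hom_simps sn_0[OF \<nu>])
  next
    case (single w c)
    have "\<nu> (scale c (basis w - \<sigma> (canonical_hom (basis w)))) = 0"
      by (simp add: sn_scale[OF \<nu>] basis)
    then show ?case
      unfolding single_eq_scale[of w c]
      by (simp add: \<sigma>_def canonical_hom_simps alg_target.extend_scale scale_diff flip: scale_def)
  next
    case (add x y)
    then show ?case using sn_mod_add[OF \<nu>]
      by (simp add: \<sigma>_def canonical_hom_simps alg_target.extend_add)
  qed
  from this[of x] show ?thesis by (simp add: x \<sigma>_def alg_target.extend_0)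
qed

section \<open>The defining relations under the canonical map\<close>

lemma sum_scale_delta:
  fixes f :: "'k::finite \<Rightarrow> complex"
  shows "(\<Sum>k\<in>UNIV. scale (f k) (if k = j then 1 else 0)) = scale (f j) (1 :: 'm::star_monoid star_alg)"
    and "(\<Sum>k\<in>UNIV. scale (f k) (if j = k then 1 else 0)) = scale (f j) (1 :: 'm::star_monoid star_alg)"
proof -
  have [simp]: "scale c (0 :: 'm star_alg) = 0" for c by (simp add: scale_def)
  have "scale (f k) (if k = j then 1 else 0) = (if k = j then scale (f k) 1 else (0 :: 'm star_alg))" for k
    by simp
  then show 1: "(\<Sum>k\<in>UNIV. scale (f k) (if k = j then 1 else 0)) = scale (f j) (1 :: 'm star_alg)"
    by (simp add: sum.delta)
  then show "(\<Sum>k\<in>UNIV. scale (f k) (if j = k then 1 else 0)) = scale (f j) (1 :: 'm star_alg)"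
    by (simp add: eq_commute[of j])
qed

text \<open>The matrices \<open>p\<close> and \<open>q\<close> both become the identity matrix,
  which is magic, fixes every vector and satisfies \<open>A p = q A\<close>. Only the partial
  isometry relations need an argument.\<close>

lemma canonical_hom_G_inf_rel:
  assumes "(a, b) \<in> G_inf_rel A"
  shows "canonical_hom a = canonical_hom b"
proof -
  \<comment> \<open>A product of generators maps to zero as soon as one factor is off-diagonal and
    to a group element otherwise; both are partial isometries.\<close>
  have prod: "canonical_hom (prod_list (map2 u_gen \<alpha> \<beta>)) = 0 \<or>
      (\<exists>g. canonical_hom (prod_list (map2 u_gen \<alpha> \<beta>)) = basis g)" for \<alpha> \<beta> :: "'a list"
  proof (induction \<alpha> \<beta> rule: list_induct2')
    case (4 i \<alpha> j \<beta>)
    then show ?case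
      by (auto simp: canonical_hom_simps simp flip: basis_add)
  qed (auto simp: canonical_hom_simps intro: exI[of _ 0])
  have pi: "y * star y * y = y" if "y = 0 \<or> (\<exists>g. y = basis g)" for y :: "'a free_group star_alg"
    using that by (auto simp: mult_single mstar_eq_uminus)
  show ?thesis
    using assms unfolding G_inf_rel_def magic_unitary_rel_def fixes_vector_rel_def partial_isometry_rel_def
    by (auto simp: canonical_hom_simps canonical_hom_p_gen canonical_hom_q_gen sum_scale_delta
        mult_single mstar_eq_uminus pi[OF prod, simplified])
qed

text \<open>Once the off-diagonal generators vanish, the row sums of \<open>p\<close> and
  \<open>q\<close> reduce to their diagonal entries, which makes each \<open>u_gen i i\<close>
  unitary modulo \<open>\<nu>\<close>. The kernel condition of \<open>universal_iso\<close>
  follows.\<close>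

lemma C_G_inf_iso:
  assumes off: "\<And>\<nu> i j. \<nu> \<in> admissible (G_inf_rel A) \<Longrightarrow> i \<noteq> j \<Longrightarrow> \<nu> (u_gen i j) = 0"
  shows "\<exists>\<phi>\<in>cstar_iso (C_G_inf A) (full_group_cstar :: (nat \<Rightarrow> 'n::finite free_group star_alg) set cstar).
    \<forall>i j. \<phi> (u_elem A i j) =
      (if i = j then group_unitary (free_gen i)
       else \<zero>\<^bsub>full_group_cstar :: (nat \<Rightarrow> 'n free_group star_alg) set cstar\<^esub>)"
proof -
  have "\<nu> x = 0" if \<nu>: "\<nu> \<in> admissible (G_inf_rel A)" and x: "canonical_hom x = 0" for \<nu> x
  proof (rule canonical_hom_kernel[OF _ _ _ _ x])
    show sn: "cstar_seminorm \<nu>" using \<nu> by (simp add: admissible_def)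
    show "\<nu> (u_gen i j) = 0" if "i \<noteq> j" for i j using off[OF \<nu> that] .
    have row: "\<nu> (r i - 1) = 0"
      if "(\<Sum>j\<in>UNIV. r j, 1) \<in> G_inf_rel A" "\<And>j. j \<noteq> i \<Longrightarrow> \<nu> (r j) = 0"
      for r :: "'n \<Rightarrow> ('n \<times> 'n) star_word star_alg" and i
    proof -
      have "\<nu> (\<Sum>j\<in>J. r j) = 0" if "i \<notin> J" for J
        using that
      proof (induction J rule: infinite_finite_induct)
        case (insert j J)
        then show ?case
          using sn_add[OF sn, of "r j" "sum r J"] sn_nonneg[OF sn, of "r j + sum r J"]
            \<open>\<And>j. j \<noteq> i \<Longrightarrow> \<nu> (r j) = 0\<close>[of j] by auto
      qed (simp_all add: sn_0[OF sn])
      then have "\<nu> (\<Sum>j\<in>UNIV-{i}. r j) = 0" by blast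
      moreover have "(\<Sum>j\<in>UNIV. r j) = r i + (\<Sum>j\<in>UNIV-{i}. r j)"
        by (simp add: sum.remove[of UNIV i])
      moreover have "\<nu> ((\<Sum>j\<in>UNIV. r j) - 1) = 0" using \<nu> that(1) by (auto simp: admissible_def)
      ultimately show ?thesis
        using sn_triangle[OF sn, of "r i" 1 "\<Sum>j\<in>UNIV. r j"] sn_nonneg[OF sn, of "r i - 1"] sn_uminus[OF sn]
        by simp
    qed
    show "\<nu> (u_gen i i * star (u_gen i i) - 1) = 0" for i
      unfolding p_gen_def[symmetric]
    proof (rule row[of "p_gen i" i])
      show "(\<Sum>j\<in>UNIV. p_gen i j, 1) \<in> G_inf_rel A" by (auto simp: G_inf_rel_def magic_unitary_rel_def)
      show "\<nu> (p_gen i j) = 0" if "j \<noteq> i" for j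
        using off[OF \<nu>, of i j] that by (auto simp: p_gen_def intro!: sn_zero_mult[OF sn])
    qed
    show "\<nu> (star (u_gen i i) * u_gen i i - 1) = 0" for i
      unfolding q_gen_def[symmetric]
    proof (rule row[of "q_gen i" i])
      show "(\<Sum>j\<in>UNIV. q_gen i j, 1) \<in> G_inf_rel A" by (auto simp: G_inf_rel_def magic_unitary_rel_def)
      show "\<nu> (q_gen i j) = 0" if "j \<noteq> i" for j
        using off[OF \<nu>, of i j] that by (auto simp: q_gen_def intro!: sn_zero_mult[OF sn])
    qed
  qed
  then obtain \<phi> where \<phi>: "\<phi> \<in> cstar_iso (universal_cstar (G_inf_rel A)) (universal_cstar {})"
    "\<And>x. \<phi> (universal_map (G_inf_rel A) x) = universal_map {} (canonical_hom x :: 'n free_group star_alg)"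
    using universal_iso[OF bounded_relations_G_inf[of A] bounded_relations_group star_alg_hom_canonical
        surj_canonical_hom canonical_hom_G_inf_rel[of _ _ A]] by blast
  have "\<zero>\<^bsub>full_group_cstar :: (nat \<Rightarrow> 'n free_group star_alg) set cstar\<^esub> = universal_map {} 0"
    by (simp add: full_group_cstar_def universal_cstar_def universal_map_def cstar_completion_def)
  then show ?thesis
    using \<phi> unfolding C_G_inf_def full_group_cstar_def u_elem_def group_unitary_def
    by (intro bexI[of _ \<phi>]) (simp_all add: canonical_hom_u_gen)
qed

section \<open>Classical automorphisms as characters\<close>

text \<open>The permutation matrix of \<open>\<tau>\<close> is a magic unitary with scalar entries,
  and invariance of \<open>T\<close> makes it commute with \<open>T\<close>. The modulus of the
  resulting character is a C*-seminorm.\<close>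

lemma character_admissible:
  fixes T :: "complex^'k::finite^'k"
  assumes \<tau>: "bij \<tau>" and T: "\<And>i j. T $ \<tau> i $ \<tau> j = T $ i $ j"
  shows "(\<lambda>x. cmod (complex_target.word_hom (\<lambda>(i, j). of_bool (i = \<tau> j)) x)) \<in> admissible (QAut_rel T)"
proof -
  let ?\<chi> = "complex_target.word_hom (\<lambda>(i, j). of_bool (i = \<tau> j))"
  have "?\<chi> a = ?\<chi> b" if "(a, b) \<in> QAut_rel T" for a b
  proof -
    have s1: "(\<Sum>k\<in>UNIV. f k * of_bool (i = \<tau> k)) = f (inv_into UNIV \<tau> i)" for f :: "'k \<Rightarrow> complex" and i
    proof -
      have "(i = \<tau> k) = (k = inv_into UNIV \<tau> i)" for k using \<tau> by (metis bij_inv_eq_iff)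
      then show ?thesis by (simp add: of_bool_def if_distrib cong: if_cong)
    qed
    have s2: "(\<Sum>k\<in>UNIV. f k * of_bool (k = \<tau> j)) = f (\<tau> j)" for f :: "'k \<Rightarrow> complex" and j
      by (simp add: of_bool_def if_distrib cong: if_cong)
    have s3: "(\<Sum>k\<in>UNIV. of_bool (k = \<tau> j)) = (1 :: complex)" "(\<Sum>k\<in>UNIV. of_bool (i = \<tau> k)) = (1 :: complex)" for i j
      using s1[of "\<lambda>_. 1" i] s2[of "\<lambda>_. 1" j] by simp_all
    \<comment> \<open>The \<open>(i, j)\<close> entries of \<open>pT\<close> and \<open>Tp\<close>
      for the permutation matrix \<open>p\<close>.\<close>
    have "T $ inv_into UNIV \<tau> i $ j = T $ i $ \<tau> j" for i j
      using T[of "inv_into UNIV \<tau> i" j] \<tau> by (simp add: bij_is_surj surj_f_inv_f)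
    then show ?thesis
      using that unfolding QAut_rel_def magic_unitary_rel_def
      by (auto simp: complex_target.word_hom_simps s1 s2 s3)
  qed
  then show ?thesis
    by (auto simp: admissible_def cstar_seminorm_def complex_target.word_hom_simps norm_triangle_ineq norm_mult
        power2_eq_square)
qed

text \<open>If \<open>u_gen a a\<close> were a scalar \<open>c\<close>, the character of the
  identity would force \<open>c = 1\<close> and that of \<open>\<tau>\<close>, which moves
  \<open>a\<close>, would force \<open>c = 0\<close>.\<close>

lemma QAut_nontrivial:
  fixes T :: "complex^'k::finite^'k"
  assumes \<tau>: "bij \<tau>" "\<tau> a \<noteq> a" and T: "\<And>i j. T $ \<tau> i $ \<tau> j = T $ i $ j"
  shows "\<not> QAut_trivial T"
proof
  assume trivial: "QAut_trivial T"
  let ?R = "QAut_rel T"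
  note R = bounded_relations_QAut[of T]
  note rep = universal_map_star_rep[OF R, unfolded star_rep_def]
  have "universal_map ?R (u_gen a a) \<in> carrier (C_QAut T)" using rep by (simp add: C_QAut_def)
  then obtain c where "universal_map ?R (u_gen a a) = cscale (C_QAut T) c \<one>\<^bsub>C_QAut T\<^esub>"
    using trivial by (auto simp: QAut_trivial_def)
  also have "\<dots> = universal_map ?R (scale c 1)" using rep by (simp add: C_QAut_def)
  \<comment> \<open>Equal classes of constant sequences mean that the constant difference has
    seminorm zero.\<close>
  finally have "max_seminorm ?R (u_gen a a - scale c 1) = 0"
    unfolding universal_map_def
    using max_seminorm_cstar[OF R] LIMSEQ_const_iff[of "max_seminorm ?R (u_gen a a - scale c 1)" 0]
    by (simp add: class_eq cauchy_const null_seq_def)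
  then have zero: "\<nu> (u_gen a a - scale c 1) \<le> 0" if "\<nu> \<in> admissible ?R" for \<nu>
    using max_seminorm_upper[OF R that] by metis
  have "c = 1"
    using zero[OF character_admissible[of id]] by (simp add: complex_target.word_hom_simps)
  moreover have "c = 0"
    using zero[OF character_admissible[OF \<tau>(1) T]] \<tau>(2) by (simp add: complex_target.word_hom_simps)
  ultimately show False by simp
qed

section \<open>The golden mean matrix\<close>

definition golden :: "real^2^2" where
  "golden = (\<chi> i j. if i = 2 \<and> j = 2 then 0 else 1)"

text \<open>The vector is defined by \<open>THE\<close>, so the eigenvector equation is solved
  completely: existence and uniqueness come with the explicit entries.\<close>

lemma perron_vector_golden: "perron_vector golden $ 1 \<noteq> perron_vector golden $ 2"
proof -
  have iff: "is_perron_vector golden w \<longleftrightarrow> w $ 1 = (sqrt 5 - 1) / 2 \<and> w $ 2 = (3 - sqrt 5) / 2" for w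
  proof
    assume "is_perron_vector golden w"
    then obtain r where r: "w $ 1 + w $ 2 = r * w $ 1" "w $ 1 = r * w $ 2"
      and pos: "0 < w $ 1" "0 < w $ 2" and sum: "w $ 1 + w $ 2 = 1"
      by (auto simp: is_perron_vector_def golden_def vec_eq_iff matrix_vector_mult_def forall_2 sum_2)
    \<comment> \<open>Multiplying the second equation by \<open>w $ 1\<close> and using
      \<open>r * w $ 1 = 1\<close> eliminates \<open>r\<close>. This leaves x^2 = 1 - x, whose
      positive root is wanted.\<close>
    have "w $ 1 * w $ 1 = (r * w $ 1) * w $ 2" by (subst (2) r(2)) (simp only: mult_ac)
    moreover have "r * w $ 1 = 1" using r(1) sum by simp
    ultimately have "w $ 1 * w $ 1 = 1 - w $ 1" using sum by simp
    then have "(2 * w $ 1 + 1)\<^sup>2 = 5" by (simp add: power2_eq_square algebra_simps)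
    then have "2 * w $ 1 + 1 = sqrt 5" using pos by (metis real_sqrt_unique less_eq_real_def add_nonneg_nonneg mult_nonneg_nonneg zero_le_numeral zero_le_one)
    then show "w $ 1 = (sqrt 5 - 1) / 2 \<and> w $ 2 = (3 - sqrt 5) / 2" using sum by (auto simp: field_simps)
  next
    assume w: "w $ 1 = (sqrt 5 - 1) / 2 \<and> w $ 2 = (3 - sqrt 5) / 2"
    have bounds: "1 < sqrt 5" "sqrt 5 < 3" by (auto simp: real_less_lsqrt)
    \<comment> \<open>The golden ratio, the Perron--Frobenius eigenvalue.\<close>
    define r where "r = (1 + sqrt 5) / 2"
    have "w $ 1 + w $ 2 = r * w $ 1" "w $ 1 = r * w $ 2"
      "w $ 1 + w $ 2 = 1" "0 < w $ 1" "0 < w $ 2"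
      using bounds by (simp_all add: r_def conjunct1[OF w] conjunct2[OF w] field_simps)
    then show "is_perron_vector golden w"
      unfolding is_perron_vector_def
      by (intro conjI exI[of _ r])
         (simp_all add: golden_def vec_eq_iff matrix_vector_mult_def forall_2 sum_2)
  qed
  define w :: "real^2" where "w = vector [(sqrt 5 - 1) / 2, (3 - sqrt 5) / 2]"
  have "perron_vector golden = w"
    unfolding perron_vector_def iff by (rule the_equality) (auto simp: w_def vec_eq_iff forall_2)
  \<comment> \<open>The two entries coincide exactly when \<open>sqrt 5 = 2\<close>.\<close>
  moreover have "sqrt 5 \<noteq> 2"
  proof
    assume "sqrt 5 = 2"
    then have "(sqrt 5)\<^sup>2 = 2\<^sup>2" by simp
    then show False by simp
  qed
  ultimately show ?thesis by (simp add: w_def)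
qed

text \<open>Eliminating \<open>p_gen i i\<close> between the row sum and the eigenvector relation
  leaves a nonzero multiple of \<open>p_gen i j\<close>.\<close>

lemma off_diagonal_zero:
  fixes A :: "real^2^2"
  assumes w: "perron_vector A $ 1 \<noteq> perron_vector A $ 2"
    and \<nu>: "\<nu> \<in> admissible (G_inf_rel A)" and ij: "i \<noteq> j"
  shows "\<nu> (u_gen i j) = 0"
proof -
  have sn: "cstar_seminorm \<nu>" using \<nu> by (simp add: admissible_def)
  let ?c = "\<lambda>i. complex_of_real (perron_vector A $ i)"
  have UNIV: "sum f UNIV = f i + f j" for f :: "2 \<Rightarrow> 'b::comm_monoid_add"
    using ij exhaust_2[of i] exhaust_2[of j] by (auto simp: sum_2 add.commute)
  have "(\<Sum>k\<in>UNIV. p_gen i k, 1) \<in> G_inf_rel A" "(\<Sum>k\<in>UNIV. scale (?c k) (p_gen i k), scale (?c i) 1) \<in> G_inf_rel A"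
    by (auto simp: G_inf_rel_def magic_unitary_rel_def fixes_vector_rel_def)
  then have p: "\<nu> (p_gen i i + p_gen i j - 1) = 0" "\<nu> (scale (?c i) (p_gen i i) + scale (?c j) (p_gen i j) - scale (?c i) 1) = 0"
    using \<nu> unfolding admissible_def UNIV by auto
  have "scale (?c j - ?c i) (p_gen i j) = (scale (?c i) (p_gen i i) + scale (?c j) (p_gen i j) - scale (?c i) 1)
      + scale (- ?c i) (p_gen i i + p_gen i j - 1)"
    by (simp add: scale_def algebra_simps single_diff single_uminus)
  then have "\<nu> (scale (?c j - ?c i) (p_gen i j)) \<le> 0"
    using sn_add[OF sn, of "scale (?c i) (p_gen i i) + scale (?c j) (p_gen i j) - scale (?c i) 1"
        "scale (- ?c i) (p_gen i i + p_gen i j - 1)"] p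
    by (simp add: sn_scale[OF sn])
  moreover have "?c j - ?c i \<noteq> 0"
    using w ij exhaust_2[of i] exhaust_2[of j] by auto
  ultimately have "\<nu> (p_gen i j) = 0"
    using sn_nonneg[OF sn, of "p_gen i j"] by (simp add: sn_scale[OF sn] mult_le_0_iff)
  \<comment> \<open>The C*-identity for the adjoint passes from \<open>p_gen i j\<close> to the
    generator itself.\<close>
  then show ?thesis
    using sn_star_mult[OF sn, of "star (u_gen i j)"] by (simp add: p_gen_def sn_star[OF sn])
qed

theorem proposition5p14:
  shows "\<exists>A :: real^2^2. zero_one_matrix A \<and> primitive_matrix A \<and>
    (\<exists>\<phi>\<in>cstar_iso (C_G_inf A) (full_group_cstar :: (nat \<Rightarrow> 2 free_group star_alg) set cstar).
       \<forall>i j. \<phi> (u_elem A i j) =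
         (if i = j then group_unitary (free_gen i)
          else \<zero>\<^bsub>full_group_cstar :: (nat \<Rightarrow> 2 free_group star_alg) set cstar\<^esub>)) \<and>
    \<not> QAut_trivial (T_matrix A)"
proof (intro exI[of _ golden] conjI)
  show "zero_one_matrix golden" by (simp add: zero_one_matrix_def golden_def)
  \<comment> \<open>The square is ((2, 1), (1, 1)).\<close>
  have "0 < matrix_power golden 2 $ i $ j" for i j
    using exhaust_2[of i] exhaust_2[of j]
    by (auto simp: numeral_2_eq_2 golden_def matrix_matrix_mult_def mat_def sum_2)
  then show "primitive_matrix golden" unfolding primitive_matrix_def by (intro exI[of _ 2]) simp
  show "\<exists>\<phi>\<in>cstar_iso (C_G_inf golden) (full_group_cstar :: (nat \<Rightarrow> 2 free_group star_alg) set cstar).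
      \<forall>i j. \<phi> (u_elem golden i j) =
        (if i = j then group_unitary (free_gen i)
         else \<zero>\<^bsub>full_group_cstar :: (nat \<Rightarrow> 2 free_group star_alg) set cstar\<^esub>)"
    by (rule C_G_inf_iso) (rule off_diagonal_zero[OF perron_vector_golden])
  show "\<not> QAut_trivial (T_matrix golden)"
  proof (rule QAut_nontrivial)
    show "bij (prod.swap :: 2 \<times> 2 \<Rightarrow> 2 \<times> 2)" by simp
    show "prod.swap (1, 2) \<noteq> (1, 2 :: 2)" by simp
    show "T_matrix golden $ prod.swap i $ prod.swap j = T_matrix golden $ i $ j" for i j
    proof -
      \<comment> \<open>Swapping both index pairs transposes and exchanges the two factors, so
        symmetry of \<open>golden\<close> gives the invariance.\<close>
      have "T_matrix golden $ r $ s = golden $ snd s $ fst r * golden $ snd r $ fst s" for r s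
        by (simp add: T_matrix_def kronecker_def flip_matrix_def matrix_matrix_mult_def transpose_def if_distrib cong: if_cong)
      moreover have "golden $ x $ y = golden $ y $ x" for x y by (simp add: golden_def)
      ultimately show ?thesis by (simp add: mult.commute)
    qed
  qed
qed

end
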